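(* Let $h=h_n\in(0,1)$ be a sequence (possibly depending on $n$), and consider the regression model $Y_i=\mathbf 1(X_i\in G)+\xi_i$, $i=1,\ldots,n$, with the tests $T_n^0$, $T_n^1$ of $H_0: G=\emptyset$ against $H_1: |G|\ge h$, and the quantities $\gamma_n(\cdot,\cdot)$, all as defined in the context. 1. Assume that the design is (DD) or (RD), and that the noise satisfies $\mathbb P[\xi_1\le -1/2]<\mathbb P[\xi_1\le 1/2]$. Then, if $nh\to\infty$ as $n\to\infty$, the test $T_n^0$ is consistent on $\mathcal S_0$, i.e. $\gamma_n(T_n^0,\mathcal S_0)\to 0$. If, in addition, the noise is Gaussian, then a separation rate on the class $\mathcal S_0$ is $r_n=1/n$. 2. Assume that the design is (DD) or (RD). Then, if $nh/\ln n\to\infty$ as $n\to\infty$, the test $T_n^1$ is consistent on $\mathcal S$, i.e. $\gamma_n(T_n^1,\mathcal S)\to 0$. If, in addition, the noise is Gaussian, then a separation rate on the class $\mathcal S$ is $r_n=\ln(n)/n$.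
   Context: Model: for each $n$ one observes $(X_1,Y_1),\ldots,(X_n,Y_n)$ with $Y_i=\mathbf 1(X_i\in G)+\xi_i$, where $\mathbf 1(\cdot)$ is the indicator function and $G\subseteq[0,1]$ is an unknown segment, possibly empty. The noise terms $\xi_1,\ldots,\xi_n$ are i.i.d., independent of the design $\mathcal X=\{X_1,\ldots,X_n\}$, and subgaussian: there is a constant $\sigma>0$ with $\mathbb E[e^{u\xi_i}]\le e^{\sigma^2u^2/2}$ for all $u\in\mathbb R$. When the noise is said to be Gaussian, the $\xi_i$ are centered Gaussian with variance $\sigma^2>0$. Designs: (DD) $X_i=i/n$, $i=1,\ldots,n$; (RD) $X_1\le\cdots\le X_n$ is the increasing reordering of $n$ i.i.d. uniform random variables on $[0,1]$. Notation: $|\cdot|$ is Lebesgue measure, $\#$ is cardinality, and $\mathbb P_G$ is the law of the observations when the unknown set is $G$. The classes are $\mathcal S=\{[a,b]:0\le a\le b\le 1\}$ and $\mathcal S_0=\{[0,\theta]:0\le\theta\le1\}$. Tests: a test $\tau_n$ is a $\{0,1\}$-valued random variable built from the data; $H_0$ is rejected if and only if $\tau_n=1$. For a class $\mathcal C$, $$\gamma_n(\tau_n,\mathcal C)=\mathbb P_\emptyset[\tau_n=1]+\sup_{G\in\mathcal C,\ |G|\ge h}\mathbb P_G[\tau_n=0].$$ The test $\tau_n$ is consistent on $\mathcal C$ if $\gamma_n(\tau_n,\mathcal C)\to0$ as $n\to\infty$. A separation rate on $\mathcal C$ is a sequence of positive numbers $r_n$ such that: if $h/r_n\to\infty$ there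 exists a consistent test on $\mathcal C$; and if $h/r_n\to0$ no test is consistent on $\mathcal C$. Test $T_n^0$: let $N=\max\{i=1,\ldots,n: X_i\le h\}=\#(\mathcal X\cap[0,h])$ (with $N=0$ if there is no such $i$), $S=\#\{i=1,\ldots,N: Y_i\le 1/2\}$, fix a constant $c\in(\mathbb P[\xi_1\le-1/2],\mathbb P[\xi_1\le1/2])$, and put $T_n^0=\mathbf 1(S\le cN)$. Test $T_n^1$: for $G'\in\mathcal S$ let $R(G')=\sum_{i=1}^nY_i\mathbf 1(X_i\in G')-\frac{\#(\mathcal X\cap G')}{2}$, let $R=\sup_{G'\in\mathcal S,\,|G'|\ge h}R(G')$, and put $T_n^1=\mathbf 1(R\ge0)$. *)

theory Defs
  imports "HOL-Probability.Probability"
begin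

text \<open>
  Everything is expressed through the law of the observations. A sample of size \<open>n\<close> is a pair
  \<open>(x, y)\<close> of extensional functions on \<open>{1..n}\<close>: the design points and the responses.
\<close>

type_synonym sample = "(nat \<Rightarrow> real) \<times> (nat \<Rightarrow> real)"

definition vec_space :: "nat \<Rightarrow> (nat \<Rightarrow> real) measure" where
  "vec_space n = (\<Pi>\<^sub>M i\<in>{1..n}. borel)"

definition sample_space :: "nat \<Rightarrow> sample measure" where
  "sample_space n = vec_space n \<Otimes>\<^sub>M vec_space n"


subsection \<open>Noise and design\<close>

text \<open>Integrability is required explicitly, because the Bochner integral of a non-integrable
  function is 0.\<close>

definition subgaussian_noise :: "real \<Rightarrow> real measure \<Rightarrow> bool" where
  "subgaussian_noise \<sigma> \<nu> \<longleftrightarrow>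
     prob_space \<nu> \<and> sets \<nu> = sets borel \<and>
     (\<forall>u. integrable \<nu> (\<lambda>x. exp (u * x)) \<and>
          (\<integral>x. exp (u * x) \<partial>\<nu>) \<le> exp (\<sigma>\<^sup>2 * u\<^sup>2 / 2))"

definition gaussian_noise :: "real \<Rightarrow> real measure \<Rightarrow> bool" where
  "gaussian_noise \<sigma> \<nu> \<longleftrightarrow> \<nu> = density lborel (\<lambda>x. ennreal (normal_density 0 \<sigma> x))"

definition deterministic_design :: "nat \<Rightarrow> (nat \<Rightarrow> real) measure" where
  "deterministic_design n = return (vec_space n) (\<lambda>i\<in>{1..n}. real i / real n)"

definition increasing_reordering :: "nat \<Rightarrow> (nat \<Rightarrow> real) \<Rightarrow> nat \<Rightarrow> real" where
  "increasing_reordering n u = (\<lambda>i\<in>{1..n}. sort (map u [1..<Suc n]) ! (i - 1))"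

definition random_design :: "nat \<Rightarrow> (nat \<Rightarrow> real) measure" where
  "random_design n =
     distr (\<Pi>\<^sub>M i\<in>{1..n}. uniform_measure lborel {0..1}) (vec_space n) (increasing_reordering n)"

text \<open>The product measure expresses that the noise is i.i.d. and independent of the design.\<close>

definition obs_law ::
  "(nat \<Rightarrow> (nat \<Rightarrow> real) measure) \<Rightarrow> real measure \<Rightarrow> nat \<Rightarrow> real set \<Rightarrow> sample measure" where
  "obs_law D \<nu> n G =
     distr (D n \<Otimes>\<^sub>M (\<Pi>\<^sub>M i\<in>{1..n}. \<nu>)) (sample_space n)
       (\<lambda>(x, \<xi>). (x, \<lambda>i\<in>{1..n}. indicator G (x i) + \<xi> i))"


subsection \<open>Tests, consistency, separation rates\<close>

definition segments :: "real set set" where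
  "segments = {{a..b} | a b. 0 \<le> a \<and> a \<le> b \<and> b \<le> 1}"

definition segments0 :: "real set set" where
  "segments0 = {{0..\<theta>} | \<theta>. 0 \<le> \<theta> \<and> \<theta> \<le> 1}"

definition long_members :: "real set set \<Rightarrow> real \<Rightarrow> real set set" where
  "long_members C h = {G \<in> C. measure lborel G \<ge> h}"

definition is_test :: "nat \<Rightarrow> (sample \<Rightarrow> nat) \<Rightarrow> bool" where
  "is_test n \<tau> \<longleftrightarrow> \<tau> \<in> sample_space n \<rightarrow>\<^sub>M count_space {0, 1}"

definition test_risk ::
  "(nat \<Rightarrow> (nat \<Rightarrow> real) measure) \<Rightarrow> real measure \<Rightarrow> nat \<Rightarrow> real \<Rightarrow> (sample \<Rightarrow> nat)
     \<Rightarrow> real set set \<Rightarrow> real" where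
  "test_risk D \<nu> n h \<tau> C =
     measure (obs_law D \<nu> n {}) {\<omega> \<in> space (sample_space n). \<tau> \<omega> = 1} +
     (SUP G\<in>long_members C h.
        measure (obs_law D \<nu> n G) {\<omega> \<in> space (sample_space n). \<tau> \<omega> = 0})"

text \<open>Measurability is part of consistency: \<^const>\<open>measure\<close> is 0 on non-measurable sets, so the
  convergence alone would say nothing about a non-measurable \<open>\<tau>\<close>.\<close>

definition consistent_test ::
  "(nat \<Rightarrow> (nat \<Rightarrow> real) measure) \<Rightarrow> real measure \<Rightarrow> (nat \<Rightarrow> real) \<Rightarrow> real set set
     \<Rightarrow> (nat \<Rightarrow> sample \<Rightarrow> nat) \<Rightarrow> bool" where
  "consistent_test D \<nu> h C \<tau> \<longleftrightarrow>
     (\<forall>n\<ge>1. is_test n (\<tau> n)) \<and> (\<lambda>n. test_risk D \<nu> n (h n) (\<tau> n) C) \<longlonglongrightarrow> 0"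

text \<open>A separation rate is a property of \<open>r\<close> with respect to all sequences \<open>h\<close>. Positivity of \<open>r\<close>
  is required only for large \<open>n\<close>, since \<open>ln n / n\<close> vanishes at \<open>n = 1\<close>.\<close>

definition separation_rate ::
  "(nat \<Rightarrow> (nat \<Rightarrow> real) measure) \<Rightarrow> real measure \<Rightarrow> real set set \<Rightarrow> (nat \<Rightarrow> real) \<Rightarrow> bool" where
  "separation_rate D \<nu> C r \<longleftrightarrow>
     (\<forall>\<^sub>F n in sequentially. 0 < r n) \<and>
     (\<forall>h. (\<forall>n\<ge>1. 0 < h n \<and> h n < 1) \<longrightarrow>
        (filterlim (\<lambda>n. h n / r n) at_top sequentially \<longrightarrow> (\<exists>\<tau>. consistent_test D \<nu> h C \<tau>)) \<and>
        ((\<lambda>n. h n / r n) \<longlonglongrightarrow> 0 \<longrightarrow> \<not> (\<exists>\<tau>. consistent_test D \<nu> h C \<tau>)))"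


subsection \<open>The two tests\<close>

definition last_index :: "nat \<Rightarrow> real \<Rightarrow> (nat \<Rightarrow> real) \<Rightarrow> nat" where
  "last_index n h x =
     (if \<exists>i\<in>{1..n}. x i \<le> h then Max {i \<in> {1..n}. x i \<le> h} else 0)"

definition test0 :: "real \<Rightarrow> nat \<Rightarrow> real \<Rightarrow> sample \<Rightarrow> nat" where
  "test0 c n h = (\<lambda>(x, y).
     let N = last_index n h x;
         S = card {i \<in> {1..N}. y i \<le> 1 / 2}
     in if real S \<le> c * real N then 1 else 0)"

definition scan_stat :: "nat \<Rightarrow> sample \<Rightarrow> real set \<Rightarrow> real" where
  "scan_stat n = (\<lambda>(x, y) G.
     (\<Sum>i\<in>{1..n}. y i * indicator G (x i)) - real (card (x ` {1..n} \<inter> G)) / 2)"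

definition test1 :: "nat \<Rightarrow> real \<Rightarrow> sample \<Rightarrow> nat" where
  "test1 n h \<omega> = (if (SUP G\<in>long_members segments h. scan_stat n \<omega> G) \<ge> 0 then 1 else 0)"

end

theory Submission
  imports Defs "HOL-Real_Asymp.Real_Asymp"
begin

text \<open>
  Both parts rest on one feature shared by the two designs: the number of design points in a segment
  \<open>[a, b] \<subseteq> [0, 1]\<close> has an exponential moment
  \<open>E exp (\<kappa> * count) \<le> exp (\<bar>\<kappa>\<bar> + (exp \<kappa> - 1) * n * (b - a))\<close> for every real \<open>\<kappa>\<close>. On the grid the count
  differs from \<open>n * (b - a)\<close> by at most one; for uniform points it is binomial. Almost surely the design is
  also strictly increasing and nonnegative, and it hits \<open>[0, t]\<close> with probability at most \<open>n * t\<close>. The locale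
  \<open>spread_design\<close> collects these facts, and both designs are treated through it.

  Upper bounds. Given the design, each test errs only if a sum over some index set \<open>I\<close> of i.i.d. variables
  with negative mean is nonnegative, which by Chernoff has probability at most \<open>r ^ card I\<close> with \<open>r < 1\<close>
  (\<open>noise_chernoff\<close>). For \<open>test0\<close> the set \<open>I\<close> consists of the design points in \<open>[0, h]\<close>; averaging \<open>r ^ card I\<close>
  over the design by the moment bound with negative \<open>\<kappa>\<close> gives an error exponentially small in \<open>n * h\<close>. For
  \<open>test1\<close> under the alternative, \<open>I\<close> is the set of points in the true segment, and the same holds. Under the null
  hypothesis one needs a union bound: a segment cuts out an interval of indices, so there are at most
  \<open>n * (n + 1)\<close> index sets, and each long segment contains one of at most \<open>2 / h\<close> cells of length \<open>h / 2\<close>, so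
  that no index set can be small unless some cell count is. The resulting polynomial factor is beaten by the exponential
  as soon as \<open>n * h\<close> grows faster than \<open>ln n\<close>.

  Lower bounds. If \<open>n * h \<longlonglongrightarrow> 0\<close>, the design misses \<open>[0, h]\<close> with probability tending to one, and then the
  observations have the same law under \<open>{}\<close> and under \<open>[0, h]\<close>. For general segments and
  Gaussian noise, the null law is compared with the uniform mixture over about \<open>1 / (2 * h)\<close> disjoint segments of
  length \<open>h\<close>. The likelihood ratios of disjoint segments are uncorrelated, and the second moment of a
  single one is the exponential moment of a count with \<open>\<kappa> = 1 / \<sigma>\<^sup>2\<close>. Hence the variance of the
  mixture is at most \<open>4 * h * exp (O (1 + n * h))\<close>, which vanishes when \<open>n * h\<close> is of smaller order
  than \<open>ln n\<close>, and the risk of every test is asymptotically at least one.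
\<close>

section \<open>Designs with controlled counts\<close>

definition hits :: "nat \<Rightarrow> real set \<Rightarrow> (nat \<Rightarrow> real) \<Rightarrow> nat set" where
  "hits n G x = {i \<in> {1..n}. x i \<in> G}"

lemma hits_subset: "hits n G x \<subseteq> {1..n}"
  by (auto simp: hits_def)

lemma finite_hits [simp]: "finite (hits n G x)"
  by (auto simp: hits_def)

lemma space_vec_space: "space (vec_space n) = extensional {1..n}"
  by (auto simp: vec_space_def space_PiM PiE_def)

lemma vec_space_component [measurable]:
  "i \<in> {1..n} \<Longrightarrow> (\<lambda>x. x i) \<in> borel_measurable (vec_space n)"
  unfolding vec_space_def by measurable

lemma card_hits_eq_sum: "real (card (hits n G x)) = (\<Sum>i\<in>{1..n}. indicator G (x i))"
proof -
  have "(\<Sum>i\<in>{1..n}. indicator G (x i) :: real) = (\<Sum>i\<in>hits n G x. 1)"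
    unfolding hits_def by (intro sum.mono_neutral_cong_right) (auto simp: indicator_def)
  then show ?thesis by simp
qed

lemma card_hits_measurable [measurable]:
  assumes [measurable]: "G \<in> sets borel"
  shows "(\<lambda>x. real (card (hits n G x))) \<in> borel_measurable (vec_space n)"
  unfolding card_hits_eq_sum by measurable

text \<open>
  The two-sided moment bound replaces concentration inequalities: with \<open>\<kappa> < 0\<close> it says that a segment is
  unlikely to contain few points, with \<open>\<kappa> > 0\<close> that it is unlikely to contain many. The summand \<open>\<bar>\<kappa>\<bar>\<close> pays for
  the rounding error of a grid.
\<close>
locale spread_design = prob_space P for n :: nat and P :: "(nat \<Rightarrow> real) measure" +
  assumes sets_design: "sets P = sets (vec_space n)"
    and design_strict_mono: "AE x in P. strict_mono_on {1..n} x"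
    and design_nonneg: "AE x in P. \<forall>i\<in>{1..n}. 0 \<le> x i"
    and exp_hits_le: "\<lbrakk>0 \<le> a; a \<le> b; b \<le> 1\<rbrakk> \<Longrightarrow>
      (\<integral>x. exp (\<kappa> * real (card (hits n {a..b} x))) \<partial>P)
        \<le> exp (\<bar>\<kappa>\<bar> + (exp \<kappa> - 1) * (real n * (b - a)))"
    and hit_prob_le: "\<lbrakk>0 \<le> t; t \<le> 1\<rbrakk> \<Longrightarrow>
      measure P {x \<in> space P. hits n {0..t} x \<noteq> {}} \<le> real n * t"

section \<open>The regular grid\<close>

text \<open>
  The integers in \<open>(n * a, n * b]\<close> are all indices of points in the segment, even for \<open>a = 0\<close>, where the
  closed interval would also contain the non-index 0. This gives the lower bound; the closed interval gives the upper one.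
\<close>
lemma grid_hits_bounds:
  assumes "1 \<le> n" "0 \<le> a" "a \<le> b" "b \<le> 1"
  defines "k \<equiv> card (hits n {a..b} (\<lambda>i\<in>{1..n}. real i / real n))"
  shows "real n * (b - a) - 1 \<le> real k" "real k \<le> real n * (b - a) + 1"
proof -
  have eq: "hits n {a..b} (\<lambda>i\<in>{1..n}. real i / real n) = {i \<in> {1..n}. real n * a \<le> real i \<and> real i \<le> real n * b}"
    using assms(1) by (auto simp: hits_def field_simps)
  have sub1: "nat ` {\<lfloor>real n * a\<rfloor><..\<lfloor>real n * b\<rfloor>} \<subseteq> hits n {a..b} (\<lambda>i\<in>{1..n}. real i / real n)"
  proof
    fix i assume "i \<in> nat ` {\<lfloor>real n * a\<rfloor><..\<lfloor>real n * b\<rfloor>}"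
    then obtain j where j: "i = nat j" "\<lfloor>real n * a\<rfloor> < j" "j \<le> \<lfloor>real n * b\<rfloor>" by auto
    have "0 \<le> \<lfloor>real n * a\<rfloor>" using assms by simp
    then have jp: "0 < j" using j by linarith
    have ja: "real n * a < of_int j" "of_int j \<le> real n * b" using j by linarith+
    have "real n * b \<le> real n" using assms by (simp add: mult_left_le)
    then have "j \<le> int n" using ja by linarith
    then show "i \<in> hits n {a..b} (\<lambda>i\<in>{1..n}. real i / real n)"
      unfolding eq using j(1) jp ja by auto
  qed
  have "inj_on nat {\<lfloor>real n * a\<rfloor><..\<lfloor>real n * b\<rfloor>}"
  proof (rule inj_onI)
    fix i j assume *: "i \<in> {\<lfloor>real n * a\<rfloor><..\<lfloor>real n * b\<rfloor>}" "j \<in> {\<lfloor>real n * a\<rfloor><..\<lfloor>real n * b\<rfloor>}" "nat i = nat j"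
    have "0 \<le> \<lfloor>real n * a\<rfloor>" using assms by simp
    then have "0 < i" "0 < j" using * by (auto simp del: zero_le_floor)
    then show "i = j" using *(3) by simp
  qed
  then have "card {\<lfloor>real n * a\<rfloor><..\<lfloor>real n * b\<rfloor>} \<le> k"
    unfolding k_def using card_mono[OF _ sub1] by (simp add: card_image)
  moreover have "real (card {\<lfloor>real n * a\<rfloor><..\<lfloor>real n * b\<rfloor>}) = of_int (\<lfloor>real n * b\<rfloor> - \<lfloor>real n * a\<rfloor>)"
    using assms by (simp add: floor_mono mult_left_mono)
  ultimately show "real n * (b - a) - 1 \<le> real k"
    by (simp add: algebra_simps) linarith
  have "int ` hits n {a..b} (\<lambda>i\<in>{1..n}. real i / real n) \<subseteq> {\<lceil>real n * a\<rceil>..\<lfloor>real n * b\<rfloor>}"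
    unfolding eq by (auto simp: le_floor_iff ceiling_le_iff)
  then have "card (int ` hits n {a..b} (\<lambda>i\<in>{1..n}. real i / real n)) \<le> card {\<lceil>real n * a\<rceil>..\<lfloor>real n * b\<rfloor>}"
    by (intro card_mono) auto
  then have "k \<le> card {\<lceil>real n * a\<rceil>..\<lfloor>real n * b\<rfloor>}" unfolding k_def
    by (simp add: card_image)
  moreover have "real (card {\<lceil>real n * a\<rceil>..\<lfloor>real n * b\<rfloor>}) \<le> real n * (b - a) + 1"
  proof -
    have "0 \<le> real n * (b - a) + 1" using assms by simp
    moreover have "of_int (\<lfloor>real n * b\<rfloor> - \<lceil>real n * a\<rceil> + 1) \<le> real n * (b - a) + 1"
      by (simp add: algebra_simps) linarith
    ultimately show ?thesis by (cases "\<lfloor>real n * b\<rfloor> - \<lceil>real n * a\<rceil> + 1 \<ge> 0") auto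
  qed
  ultimately show "real k \<le> real n * (b - a) + 1" by linarith
qed

text \<open>
  The count \<open>k\<close> satisfies \<open>\<bar>k - n * (b - a)\<bar> \<le> 1\<close>, so \<open>\<kappa> * k \<le> \<bar>\<kappa>\<bar> + \<kappa> * n * (b - a)\<close> for either sign of \<open>\<kappa>\<close>,
  and \<open>\<kappa> \<le> exp \<kappa> - 1\<close> brings this into the form that also fits binomial counts.
\<close>
lemma spread_deterministic_design:
  assumes n: "1 \<le> n"
  shows "spread_design n (deterministic_design n)"
proof -
  define g where "g = (\<lambda>i\<in>{1..n}. real i / real n)"
  have g: "g \<in> space (vec_space n)" by (simp add: g_def space_vec_space)
  have D: "deterministic_design n = return (vec_space n) g"
    by (simp add: deterministic_design_def g_def)
  interpret prob_space "deterministic_design n"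
    unfolding D using g by (rule prob_space_return)
  have meas_eq: "measure (deterministic_design n) A \<le> real n * t"
    if "0 \<le> t" "g \<in> A \<Longrightarrow> 1 \<le> real n * t" for A t
  proof (cases "A \<in> sets (vec_space n)")
    case True
    then show ?thesis using that unfolding D by (simp add: measure_return indicator_def)
  next
    case False
    then show ?thesis using that unfolding D by (simp add: measure_notin_sets)
  qed
  show ?thesis
  proof
    show "sets (deterministic_design n) = sets (vec_space n)" by (simp add: D)
    have "Measurable.pred (vec_space n) (\<lambda>x. \<forall>i\<in>{1..n}. \<forall>j\<in>{1..n}. i < j \<longrightarrow> x i < x j)"
      by measurable
    then have "AE x in deterministic_design n. \<forall>i\<in>{1..n}. \<forall>j\<in>{1..n}. i < j \<longrightarrow> x i < x j"
      unfolding D using n by (subst AE_return[OF g]) (auto simp: g_def field_simps)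
    then show "AE x in deterministic_design n. strict_mono_on {1..n} x"
      by eventually_elim (auto simp: strict_mono_on_def)
    have "Measurable.pred (vec_space n) (\<lambda>x. \<forall>i\<in>{1..n}. 0 \<le> x i)"
      by measurable
    then show "AE x in deterministic_design n. \<forall>i\<in>{1..n}. 0 \<le> x i"
      unfolding D using n by (subst AE_return[OF g]) (auto simp: g_def field_simps)
  next
    fix a b \<kappa> :: real assume ab: "0 \<le> a" "a \<le> b" "b \<le> 1"
    define k where "k = real (card (hits n {a..b} g))"
    define l where "l = real n * (b - a)"
    have kl: "\<bar>k - l\<bar> \<le> 1" using grid_hits_bounds[OF n ab] unfolding k_def g_def l_def by linarith
    have l: "0 \<le> l" using ab by (simp add: l_def)
    have "\<kappa> * (k - l) \<le> \<bar>\<kappa>\<bar>"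
      using kl mult_left_le[of "\<bar>k - l\<bar>" "\<bar>\<kappa>\<bar>"] abs_le_D1[of "\<kappa> * (k - l)"] by (simp add: abs_mult)
    moreover have "\<kappa> * l \<le> (exp \<kappa> - 1) * l"
      using l exp_ge_add_one_self[of \<kappa>] by (intro mult_right_mono) linarith+
    ultimately have "\<kappa> * k \<le> \<bar>\<kappa>\<bar> + (exp \<kappa> - 1) * l" by (simp add: algebra_simps)
    moreover have "(\<integral>x. exp (\<kappa> * real (card (hits n {a..b} x))) \<partial>deterministic_design n) = exp (\<kappa> * k)"
      unfolding D k_def by (rule integral_return[OF g]) measurable
    ultimately show "(\<integral>x. exp (\<kappa> * real (card (hits n {a..b} x))) \<partial>deterministic_design n)
        \<le> exp (\<bar>\<kappa>\<bar> + (exp \<kappa> - 1) * (real n * (b - a)))"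
      by (simp add: l_def)
  next
    fix t :: real assume t: "0 \<le> t" "t \<le> 1"
    have "1 \<le> real n * t" if hit: "g \<in> {x. hits n {0..t} x \<noteq> {}}"
    proof -
      obtain i where "i \<in> hits n {0..t} g" using hit by blast
      then have "i \<in> {1..n}" "real i / real n \<le> t" by (auto simp: hits_def g_def)
      then have "1 \<le> real i" "real i \<le> real n * t" using n by (auto simp: field_simps)
      then show ?thesis by linarith
    qed
    then show "measure (deterministic_design n) {x \<in> space (deterministic_design n). hits n {0..t} x \<noteq> {}} \<le> real n * t"
      by (intro meas_eq t) auto
  qed
qed

section \<open>Ordered uniform points\<close>

abbreviation unif01 :: "real measure" where
  "unif01 \<equiv> uniform_measure lborel {0..1}"

lemma prob_space_unif01: "prob_space unif01"
  by (rule prob_space_uniform_measure) auto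

lemma sets_PiM_unif01 [measurable_cong]: "sets (\<Pi>\<^sub>M i\<in>{1..n}. unif01) = sets (vec_space n)"
  unfolding vec_space_def by (intro sets_PiM_cong) auto

lemma space_PiM_unif01: "space (\<Pi>\<^sub>M i\<in>{1..n}. unif01) = space (vec_space n)"
  by (rule sets_eq_imp_space_eq[OF sets_PiM_unif01])

lemma length_filter_sort: "length (filter Q (sort xs)) = length (filter Q xs)"
  by (metis mset_filter mset_sort size_mset)

text \<open>
  Design points are indexed from 1, list entries from 0.
\<close>
lemma card_filter_shifted:
  "card {i \<in> {1..length xs}. Q (xs ! (i - 1))} = length (filter Q xs)"
proof -
  have "{i \<in> {1..length xs}. Q (xs ! (i - 1))} = Suc ` {i. i < length xs \<and> Q (xs ! i)}"
  proof (intro set_eqI iffI)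
    fix i assume "i \<in> {i \<in> {1..length xs}. Q (xs ! (i - 1))}"
    then show "i \<in> Suc ` {i. i < length xs \<and> Q (xs ! i)}"
      by (intro image_eqI[of _ _ "i - 1"]) auto
  qed auto
  then show ?thesis by (simp add: card_image length_filter_conv_card)
qed

lemma card_filter_map_upt:
  "length (filter Q (map u [1..<Suc n])) = card {i \<in> {1..n}. Q (u i)}"
proof -
  have "{i \<in> {1..n}. Q (map u [1..<Suc n] ! (i - 1))} = {i \<in> {1..n}. Q (u i)}"
    by (auto simp: nth_map simp del: upt_Suc)
  then show ?thesis using card_filter_shifted[of "map u [1..<Suc n]" Q] by (simp del: upt_Suc)
qed

text \<open>
  Counts do not see the order, so moments of counts can be computed for the unordered i.i.d. points.
\<close>
lemma card_hits_increasing_reordering: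
  "card (hits n G (increasing_reordering n u)) = card (hits n G u)"
proof -
  have "hits n G (increasing_reordering n u)
      = {i \<in> {1..length (sort (map u [1..<Suc n]))}. sort (map u [1..<Suc n]) ! (i - 1) \<in> G}"
    by (auto simp: hits_def increasing_reordering_def simp del: upt_Suc)
  then show ?thesis
    using card_filter_shifted[of "sort (map u [1..<Suc n])" "\<lambda>z. z \<in> G"]
    unfolding length_filter_sort card_filter_map_upt by (simp only: hits_def)
qed

lemma sorted_nth_le_iff:
  fixes xs :: "real list"
  assumes "sorted xs" "k < length xs"
  shows "xs ! k \<le> t \<longleftrightarrow> k < length (filter (\<lambda>x. x \<le> t) xs)"
  using assms
proof (induction xs arbitrary: k)
  case (Cons x xs)
  show ?case
  proof (cases "x \<le> t")
    case True
    then show ?thesis using Cons by (cases k) auto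
  next
    case False
    then have "filter (\<lambda>x. x \<le> t) xs = []" using Cons.prems by (auto simp: filter_empty_conv)
    moreover have "x \<le> (x # xs) ! k" using Cons.prems by (cases k) auto
    ultimately show ?thesis using False by auto
  qed
qed simp

text \<open>
  The \<open>i\<close>-th smallest point is at most \<open>t\<close> iff at least \<open>i\<close> of the points are, which is a
  statement about a measurable count.
\<close>
lemma measurable_increasing_reordering [measurable]:
  "increasing_reordering n \<in> vec_space n \<rightarrow>\<^sub>M vec_space n"
proof -
  have "(\<lambda>u. \<lambda>i\<in>{1..n}. sort (map u [1..<Suc n]) ! (i - 1)) \<in> vec_space n \<rightarrow>\<^sub>M (\<Pi>\<^sub>M i\<in>{1..n}. borel)"
  proof (rule measurable_restrict)
    fix i assume i: "i \<in> {1..n}"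
    show "(\<lambda>u. sort (map u [1..<Suc n]) ! (i - 1)) \<in> borel_measurable (vec_space n)"
    proof (rule borel_measurable_iff_le[THEN iffD2], rule allI)
      fix t :: real
      have i': "i - 1 < n" using i by auto
      have "{u \<in> space (vec_space n). sort (map u [1..<Suc n]) ! (i - 1) \<le> t}
          = {u \<in> space (vec_space n). real (i - 1) < real (card (hits n {..t} u))}"
      proof -
        have "sort (map u [1..<Suc n]) ! (i - 1) \<le> t \<longleftrightarrow> real (i - 1) < real (card (hits n {..t} u))" for u
          using sorted_nth_le_iff[of "sort (map u [1..<Suc n])" "i - 1" t] i'
          unfolding length_filter_sort card_filter_map_upt hits_def of_nat_less_iff
          by (simp del: upt_Suc)
        then show ?thesis by simp
      qed
      also have "\<dots> \<in> sets (vec_space n)" by measurable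
      finally show "{u \<in> space (vec_space n). sort (map u [1..<Suc n]) ! (i - 1) \<le> t} \<in> sets (vec_space n)" .
    qed
  qed
  then show ?thesis unfolding increasing_reordering_def[abs_def] vec_space_def[symmetric] .
qed

lemma strict_mono_increasing_reordering:
  assumes "inj_on u {1..n}"
  shows "strict_mono_on {1..n} (increasing_reordering n u)"
proof -
  have "sorted_wrt (<) (sort (map u [1..<Suc n]))"
    using assms by (simp add: strict_sorted_iff distinct_map atLeastLessThanSuc_atLeastAtMost del: upt_Suc)
  then have "sort (map u [1..<Suc n]) ! (i - 1) < sort (map u [1..<Suc n]) ! (j - 1)"
    if "1 \<le> i" "i < j" "j \<le> n" for i j
    by (rule sorted_wrt_nth_less) (use that in auto)
  then show ?thesis
    by (auto simp: strict_mono_on_def increasing_reordering_def simp del: upt_Suc One_nat_def)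
qed

lemma nonneg_increasing_reordering:
  assumes "\<forall>i\<in>{1..n}. 0 \<le> u i" "i \<in> {1..n}"
  shows "0 \<le> increasing_reordering n u i"
proof -
  have "sort (map u [1..<Suc n]) ! (i - 1) \<in> set (sort (map u [1..<Suc n]))"
    using assms by (intro nth_mem) auto
  also have "\<dots> = u ` {1..n}" by (simp add: atLeastLessThanSuc_atLeastAtMost del: upt_Suc)
  finally show ?thesis using assms by (auto simp: increasing_reordering_def)
qed

text \<open>
  Integrating out coordinate \<open>i\<close> first, \<open>u i = u j\<close> asks it to lie in a one-point set.
\<close>
lemma AE_inj_on_PiM_unif01:
  fixes n :: nat
  shows "AE u in \<Pi>\<^sub>M i\<in>{1..n}. unif01. inj_on u {1..n}"
proof -
  interpret product_prob_space "\<lambda>_::nat. unif01"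
    by (rule product_prob_spaceI) (rule prob_space_unif01)
  have *: "AE u in \<Pi>\<^sub>M i\<in>{1..n}. unif01. i \<noteq> j \<longrightarrow> u i \<noteq> u j" if i: "i \<in> {1..n}" and j: "j \<in> {1..n}" for i j
  proof (cases "i = j")
    case False
    define J where "J = {1..n} - {i}"
    have J: "finite J" "i \<notin> J" "insert i J = {1..n}" "j \<in> J" using i j False by (auto simp: J_def)
    let ?B = "{u \<in> space (\<Pi>\<^sub>M i\<in>{1..n}. unif01). u i = u j}"
    have [measurable]: "(\<lambda>u. u i) \<in> borel_measurable (\<Pi>\<^sub>M i\<in>{1..n}. unif01)" 
         "(\<lambda>u. u j) \<in> borel_measurable (\<Pi>\<^sub>M i\<in>{1..n}. unif01)"
      unfolding measurable_cong_sets[OF sets_PiM_unif01 refl] using i j by (auto simp del: One_nat_def)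
    have B: "?B \<in> sets (\<Pi>\<^sub>M i\<in>{1..n}. unif01)" by measurable
    have "emeasure (\<Pi>\<^sub>M i\<in>{1..n}. unif01) ?B = (\<integral>\<^sup>+ u. indicator ?B u \<partial>(\<Pi>\<^sub>M i\<in>insert i J. unif01))"
      using B J(3) by simp
    also have "\<dots> = (\<integral>\<^sup>+ u. \<integral>\<^sup>+ y. indicator ?B (u(i := y)) \<partial>unif01 \<partial>(\<Pi>\<^sub>M i\<in>J. unif01))"
      using B J by (intro product_nn_integral_insert) simp_all
    also have "\<dots> \<le> (\<integral>\<^sup>+ u. \<integral>\<^sup>+ y. indicator {u j} y \<partial>unif01 \<partial>(\<Pi>\<^sub>M i\<in>J. unif01))"
      using False by (intro nn_integral_mono) (auto simp: indicator_def)
    also have "\<dots> = 0"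
    proof -
      have "emeasure lborel ({0..1} \<inter> {u j}) = 0" for u :: "nat \<Rightarrow> real"
        using emeasure_mono[of "{0..1} \<inter> {u j}" "{u j}" lborel] by simp
      then show ?thesis by (simp add: divide_ennreal_def)
    qed
    finally have "emeasure (\<Pi>\<^sub>M i\<in>{1..n}. unif01) ?B = 0" by simp
    then show ?thesis using B by (intro AE_I[of _ _ ?B]) auto
  qed simp
  have "AE u in \<Pi>\<^sub>M i\<in>{1..n}. unif01. \<forall>i\<in>{1..n}. \<forall>j\<in>{1..n}. i \<noteq> j \<longrightarrow> u i \<noteq> u j"
    by (intro AE_finite_allI * ) auto
  then show ?thesis by eventually_elim (auto simp: inj_on_def)
qed

text \<open>
  The count in a segment of length \<open>l\<close> is binomial, with exponential moment
  \<open>(1 + (exp \<kappa> - 1) * l) ^ n \<le> exp ((exp \<kappa> - 1) * n * l)\<close>; the hitting probability is a union bound.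
\<close>
lemma spread_random_design: "spread_design n (random_design n)"
proof -
  let ?U = "\<Pi>\<^sub>M i\<in>{1..n}. unif01"
  interpret u: product_prob_space "\<lambda>_::nat. unif01"
    by (rule product_prob_spaceI) (rule prob_space_unif01)
  interpret U: prob_space ?U by (rule prob_space_PiM) (rule prob_space_unif01)
  have r: "increasing_reordering n \<in> ?U \<rightarrow>\<^sub>M vec_space n"
    unfolding measurable_cong_sets[OF sets_PiM_unif01 refl] by (rule measurable_increasing_reordering)
  note D = random_design_def[of n]
  interpret prob_space "random_design n"
    unfolding D by (rule U.prob_space_distr[OF r])
  have sp: "space (random_design n) = space (vec_space n)" by (simp add: D)
  have mgf: "(\<integral>x. exp (\<kappa> * real (card (hits n {a..b} x))) \<partial>random_design n) = (1 + (exp \<kappa> - 1) * (b - a)) ^ n"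
    if ab: "0 \<le> a" "a \<le> b" "b \<le> 1" for a b \<kappa> :: real
  proof -
    have one: "exp (\<kappa> * indicator {a..b} z) = 1 + (exp \<kappa> - 1) * indicator {a..b} z" for z :: real
      by (auto simp: indicator_def)
    have int1: "integrable unif01 (indicator {a..b} :: real \<Rightarrow> real)"
      by (intro finite_measure.integrable_const_bound[where B=1])
         (use prob_space_unif01 in \<open>auto simp: prob_space.finite_measure measurable_cong_sets[OF sets_uniform_measure refl]\<close>)
    have "{0..1} \<inter> {a..b} = {a..b}" using ab by auto
    then have m: "measure unif01 {a..b} = b - a" using ab by simp
    have "(\<integral>x. exp (\<kappa> * real (card (hits n {a..b} x))) \<partial>random_design n)
        = (\<integral>u. exp (\<kappa> * real (card (hits n {a..b} u))) \<partial>?U)"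
      unfolding D by (subst integral_distr[OF r]) (simp_all add: card_hits_increasing_reordering)
    also have "\<dots> = (\<integral>u. (\<Prod>i\<in>{1..n}. exp (\<kappa> * indicator {a..b} (u i))) \<partial>?U)"
      unfolding card_hits_eq_sum sum_distrib_left by (simp only: exp_sum finite_atLeastAtMost)
    also have "\<dots> = (\<Prod>i\<in>{1..n}. \<integral>z. exp (\<kappa> * indicator {a..b} z) \<partial>unif01)"
      unfolding one using int1 by (intro u.product_integral_prod) auto
    also have "(\<integral>z. exp (\<kappa> * indicator {a..b} z) \<partial>unif01) = 1 + (exp \<kappa> - 1) * (b - a)"
      unfolding one using int1 m u.prob_space by (simp add: space_uniform_measure)
    finally show ?thesis by simp
  qed
  show ?thesis
  proof
    show "sets (random_design n) = sets (vec_space n)" by (simp add: D)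
    have "AE u in ?U. strict_mono_on {1..n} (increasing_reordering n u)"
      using AE_inj_on_PiM_unif01 by eventually_elim (rule strict_mono_increasing_reordering)
    moreover have "{x \<in> space (vec_space n). strict_mono_on {1..n} x} \<in> sets (vec_space n)"
    proof -
      have "Measurable.pred (vec_space n) (\<lambda>x. \<forall>i\<in>{1..n}. \<forall>j\<in>{1..n}. i < j \<longrightarrow> x i < x j)"
        by measurable
      then show ?thesis by (simp add: strict_mono_on_def pred_def)
    qed
    ultimately show "AE x in random_design n. strict_mono_on {1..n} x"
      unfolding D by (subst AE_distr_iff[OF r]) auto
    have "AE z in unif01. 0 \<le> z"
      by (rule AE_uniform_measureI) auto
    then have "AE u in ?U. \<forall>i\<in>{1..n}. 0 \<le> u i"
      by (intro AE_finite_allI AE_PiM_component[where P="\<lambda>z. 0 \<le> z"] prob_space_unif01) auto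
    then have "AE u in ?U. \<forall>i\<in>{1..n}. 0 \<le> increasing_reordering n u i"
      by eventually_elim (blast intro: nonneg_increasing_reordering)
    then show "AE x in random_design n. \<forall>i\<in>{1..n}. 0 \<le> x i"
      unfolding D by (subst AE_distr_iff[OF r]) auto
  next
    fix a b \<kappa> :: real assume ab: "0 \<le> a" "a \<le> b" "b \<le> 1"
    have "0 \<le> 1 + (exp \<kappa> - 1) * (b - a)"
    proof -
      have "0 \<le> (1 - (b - a)) + exp \<kappa> * (b - a)"
        using ab by (intro add_nonneg_nonneg mult_nonneg_nonneg) auto
      then show ?thesis by (simp add: algebra_simps)
    qed
    then have "(1 + (exp \<kappa> - 1) * (b - a)) ^ n \<le> exp ((exp \<kappa> - 1) * (b - a)) ^ n"
      using exp_ge_add_one_self by (intro power_mono) auto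
    also have "\<dots> = exp ((exp \<kappa> - 1) * (real n * (b - a)))"
      by (simp add: exp_of_nat_mult[symmetric] algebra_simps)
    also have "\<dots> \<le> exp (\<bar>\<kappa>\<bar> + (exp \<kappa> - 1) * (real n * (b - a)))" by simp
    finally show "(\<integral>x. exp (\<kappa> * real (card (hits n {a..b} x))) \<partial>random_design n)
        \<le> exp (\<bar>\<kappa>\<bar> + (exp \<kappa> - 1) * (real n * (b - a)))"
      unfolding mgf[OF ab] .
  next
    fix t :: real assume t: "0 \<le> t" "t \<le> 1"
    have "{0..1} \<inter> {0..t} = {0..t}" using t by auto
    then have m: "measure unif01 {0..t} = t" using t by simp
    have [measurable]: "Measurable.pred (vec_space n) (\<lambda>x. hits n {0..t} x \<noteq> {})"
    proof -
      have "Measurable.pred (vec_space n) (\<lambda>x. \<exists>i\<in>{1..n}. x i \<in> {0..t})" by measurable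
      moreover have "hits n {0..t} x \<noteq> {} \<longleftrightarrow> (\<exists>i\<in>{1..n}. x i \<in> {0..t})" for x
        unfolding hits_def by blast
      ultimately show ?thesis by (simp only:)
    qed
    have hit: "hits n {0..t} (increasing_reordering n u) \<noteq> {} \<longleftrightarrow> hits n {0..t} u \<noteq> {}" for u
      using card_hits_increasing_reordering[of n "{0..t}" u] by (metis card_0_eq[OF finite_hits])
    have ev: "{u \<in> space ?U. u i \<in> {0..t}} \<in> sets ?U" if "i \<in> {1..n}" for i
    proof -
      have "{u \<in> space (vec_space n). u i \<in> {0..t}} \<in> sets (vec_space n)"
        using that by measurable
      then show ?thesis by (simp only: space_PiM_unif01 sets_PiM_unif01)
    qed
    have "measure (random_design n) {x \<in> space (random_design n). hits n {0..t} x \<noteq> {}}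
        = measure ?U {u \<in> space ?U. hits n {0..t} u \<noteq> {}}"
    proof -
      have "measure (random_design n) {x \<in> space (random_design n). hits n {0..t} x \<noteq> {}}
          = measure ?U (increasing_reordering n -` {x \<in> space (vec_space n). hits n {0..t} x \<noteq> {}} \<inter> space ?U)"
        unfolding sp unfolding D by (rule measure_distr[OF r]) measurable
      also have "increasing_reordering n -` {x \<in> space (vec_space n). hits n {0..t} x \<noteq> {}} \<inter> space ?U
          = {u \<in> space ?U. hits n {0..t} u \<noteq> {}}"
        using hit measurable_space[OF r] by blast
      finally show ?thesis .
    qed
    also have "\<dots> = measure ?U (\<Union>i\<in>{1..n}. {u \<in> space ?U. u i \<in> {0..t}})"
      by (intro arg_cong[where f="measure ?U"]) (auto simp: hits_def)
    also have "\<dots> \<le> (\<Sum>i\<in>{1..n}. measure ?U {u \<in> space ?U. u i \<in> {0..t}})"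
      using ev by (intro U.finite_measure_subadditive_finite) auto
    also have "\<dots> = (\<Sum>i\<in>{1..n}. t)"
    proof (intro sum.cong refl)
      fix i assume i: "i \<in> {1..n}"
      have "emeasure ?U {u \<in> space ?U. u i \<in> {0..t}} = emeasure unif01 {0..t}"
        using i by (intro product_prob_space.emeasure_PiM_Collect_single[OF u.product_prob_space_axioms]) auto
      then show "measure ?U {u \<in> space ?U. u i \<in> {0..t}} = t" using m by (simp add: measure_def)
    qed
    finally show "measure (random_design n) {x \<in> space (random_design n). hits n {0..t} x \<noteq> {}} \<le> real n * t"
      by simp
  qed
qed

section \<open>Measurability of the two tests\<close>

lemma sample_space_fst_snd [measurable]:
  shows "fst \<in> sample_space n \<rightarrow>\<^sub>M vec_space n" "snd \<in> sample_space n \<rightarrow>\<^sub>M vec_space n"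
  unfolding sample_space_def by measurable

lemma sample_space_components:
  assumes "i \<in> {1..n}"
  shows "(\<lambda>\<omega>. fst \<omega> i) \<in> borel_measurable (sample_space n)"
    "(\<lambda>\<omega>. snd \<omega> i) \<in> borel_measurable (sample_space n)"
  using assms measurable_compose[OF sample_space_fst_snd(1) vec_space_component]
    measurable_compose[OF sample_space_fst_snd(2) vec_space_component] by auto

lemma is_test_indicator:
  "Measurable.pred (sample_space n) Q \<Longrightarrow> is_test n (\<lambda>\<omega>. if Q \<omega> then 1 else 0)"
  unfolding is_test_def pred_def by (rule measurable_If) auto

lemma long_members_segments:
  "G \<in> long_members segments h \<longleftrightarrow> (\<exists>a b. G = {a..b} \<and> 0 \<le> a \<and> a \<le> b \<and> b \<le> 1 \<and> h \<le> b - a)"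
  by (auto simp: long_members_def segments_def)

lemma long_members_segments0:
  "G \<in> long_members segments0 h \<longleftrightarrow> (\<exists>t. G = {0..t} \<and> 0 \<le> t \<and> t \<le> 1 \<and> h \<le> t)"
  by (auto simp: long_members_def segments0_def)

text \<open>
  A description of the last index by finitely many inequalities between coordinates, from which measurability
  can be read off.
\<close>
lemma last_index_eq_iff:
  "last_index n h x = k \<longleftrightarrow>
    (if k \<in> {1..n} then x k \<le> h \<and> (\<forall>i\<in>{1..n}. k < i \<longrightarrow> h < x i)
     else k = 0 \<and> (\<forall>i\<in>{1..n}. h < x i))"
proof (cases "\<exists>i\<in>{1..n}. x i \<le> h")
  case True
  then have "{i \<in> {1..n}. x i \<le> h} \<noteq> {}" by auto
  then have "Max {i \<in> {1..n}. x i \<le> h} = k \<longleftrightarrow>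
      k \<in> {i \<in> {1..n}. x i \<le> h} \<and> (\<forall>i\<in>{i \<in> {1..n}. x i \<le> h}. i \<le> k)"
    by (intro Max_eq_iff) auto
  moreover have "last_index n h x = Max {i \<in> {1..n}. x i \<le> h}"
    using True by (simp add: last_index_def)
  moreover have "(\<forall>i\<in>{i \<in> {1..n}. x i \<le> h}. i \<le> k) \<longleftrightarrow> (\<forall>i\<in>{1..n}. k < i \<longrightarrow> h < x i)"
    by (metis (no_types, lifting) mem_Collect_eq not_le)
  moreover have "\<not> (\<forall>i\<in>{1..n}. h < x i)" using True by (simp add: not_less)
  ultimately show ?thesis by (simp only: mem_Collect_eq simp_thms if_bool_eq_conj conj_assoc) blast
next
  case False
  then have "\<forall>i\<in>{1..n}. h < x i" by (simp add: not_le)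
  moreover have "last_index n h x = 0" using False by (simp only: last_index_def if_False)
  ultimately show ?thesis by (auto dest: bspec)
qed

lemma last_index_le: "last_index n h x \<le> n"
  using last_index_eq_iff[of n h x "last_index n h x"] by (auto split: if_splits)

lemma last_index_measurable [measurable]:
  "last_index n h \<in> vec_space n \<rightarrow>\<^sub>M count_space UNIV"
proof (rule measurable_count_space_eq_countable[THEN iffD2])
  show "countable (UNIV :: nat set)" by simp
  show "last_index n h \<in> space (vec_space n) \<rightarrow> UNIV \<and>
      (\<forall>k\<in>UNIV. last_index n h -` {k} \<inter> space (vec_space n) \<in> sets (vec_space n))"
  proof safe
    fix k
    have "{x \<in> space (vec_space n). last_index n h x = k} \<in> sets (vec_space n)"
    proof (cases "k \<in> {1..n}")
      case True
      then show ?thesis unfolding last_index_eq_iff by (simp only: if_True) measurable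
    next
      case False
      then show ?thesis unfolding last_index_eq_iff by (simp only: if_False) measurable
    qed
    then show "last_index n h -` {k} \<inter> space (vec_space n) \<in> sets (vec_space n)"
      by (simp add: vimage_def Int_def conj_commute)
  qed simp
qed

text \<open>
  For a fixed value \<open>k\<close> of the last index the rejection region is a condition on a count of responses, and there are
  only finitely many values.
\<close>
lemma test0_is_test: "is_test n (test0 c n h)"
proof -
  have card_eq: "real (card {i \<in> {1..k}. snd \<omega> i \<le> 1 / 2}) = (\<Sum>i\<in>{1..k}. indicator {..1 / 2} (snd \<omega> i))" for k :: nat and \<omega> :: sample
    by (subst sum.mono_neutral_cong_right[of "{1..k}" "{i \<in> {1..k}. snd \<omega> i \<le> 1 / 2}" _ "\<lambda>_. 1"]) auto
  have k: "Measurable.pred (sample_space n) (\<lambda>\<omega>. real (card {i \<in> {1..k}. snd \<omega> i \<le> 1 / 2}) \<le> c * real k)"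
    if "k \<le> n" for k
  proof -
    have [measurable]: "(\<lambda>\<omega>. snd \<omega> i) \<in> borel_measurable (sample_space n)" if "i \<in> {1..k}" for i
      using that \<open>k \<le> n\<close> by (intro sample_space_components) auto
    show ?thesis unfolding card_eq by measurable
  qed
  have eq: "test0 c n h \<omega> = (if \<exists>k\<in>{..n}. last_index n h (fst \<omega>) = k \<and>
      real (card {i \<in> {1..k}. snd \<omega> i \<le> 1 / 2}) \<le> c * real k then 1 else 0)" for \<omega>
    using last_index_le[of n h "fst \<omega>"] by (auto simp: test0_def Let_def split: prod.splits)
  have "Measurable.pred (sample_space n) (\<lambda>\<omega>. \<exists>k\<in>{..n}. last_index n h (fst \<omega>) = k \<and>
      real (card {i \<in> {1..k}. snd \<omega> i \<le> 1 / 2}) \<le> c * real k)"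
  proof (rule pred_intros_finite)
    fix k assume "k \<in> {..n}"
    then have B: "Measurable.pred (sample_space n) (\<lambda>\<omega>. real (card {i \<in> {1..k}. snd \<omega> i \<le> 1 / 2}) \<le> c * real k)"
      by (intro k) simp
    have A: "Measurable.pred (sample_space n) (\<lambda>\<omega>. last_index n h (fst \<omega>) = k)"
      by measurable
    show "Measurable.pred (sample_space n) (\<lambda>\<omega>. last_index n h (fst \<omega>) = k \<and>
      real (card {i \<in> {1..k}. snd \<omega> i \<le> 1 / 2}) \<le> c * real k)"
      by (rule pred_intros_logic(3)[OF A B])
  qed simp
  then show ?thesis unfolding eq[abs_def] by (rule is_test_indicator)
qed

text \<open>
  The scan statistic counts distinct design values; these are counted by the indices at which a value occurs for
  the first time.
\<close>
lemma scan_stat_measurable [measurable]: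
  assumes [measurable]: "G \<in> sets borel"
  shows "(\<lambda>\<omega>. scan_stat n \<omega> G) \<in> borel_measurable (sample_space n)"
proof -
  define first where "first i x \<longleftrightarrow> (\<forall>j\<in>{1..n}. j < i \<longrightarrow> x j \<noteq> x i)" for i and x :: "nat \<Rightarrow> real"
  have "real (card (x ` {1..n} \<inter> G)) = (\<Sum>i\<in>{1..n}. if x i \<in> G \<and> first i x then 1 else 0)" for x :: "nat \<Rightarrow> real"
  proof -
    have "bij_betw x {i \<in> {1..n}. x i \<in> G \<and> first i x} (x ` {1..n} \<inter> G)"
    proof (rule bij_betw_imageI)
      show "inj_on x {i \<in> {1..n}. x i \<in> G \<and> first i x}"
      proof (rule inj_onI)
        fix i j assume i: "i \<in> {i \<in> {1..n}. x i \<in> G \<and> first i x}" and j: "j \<in> {i \<in> {1..n}. x i \<in> G \<and> first i x}"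
          and eq: "x i = x j"
        have "i < j \<longrightarrow> x i \<noteq> x j" "j < i \<longrightarrow> x j \<noteq> x i" using i j by (simp_all add: first_def)
        then have "\<not> i < j" "\<not> j < i" using eq by simp_all
        then show "i = j" by simp
      qed
      show "x ` {i \<in> {1..n}. x i \<in> G \<and> first i x} = x ` {1..n} \<inter> G"
      proof (intro equalityI subsetI)
        fix y assume "y \<in> x ` {1..n} \<inter> G"
        then have ex: "\<exists>i. i \<in> {1..n} \<and> x i = y" and "y \<in> G" by auto
        define i where "i = (LEAST i. i \<in> {1..n} \<and> x i = y)"
        have i: "i \<in> {1..n}" "x i = y" using LeastI_ex[OF ex] by (auto simp: i_def)
        have "x j \<noteq> x i" if "j \<in> {1..n}" "j < i" for j
          using not_less_Least[of j "\<lambda>i. i \<in> {1..n} \<and> x i = y"] that i(2) unfolding i_def[symmetric] by simp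
        then have "first i x" unfolding first_def by simp
        with i \<open>y \<in> G\<close> show "y \<in> x ` {i \<in> {1..n}. x i \<in> G \<and> first i x}" by auto
      qed auto
    qed
    then have "card (x ` {1..n} \<inter> G) = card {i \<in> {1..n}. x i \<in> G \<and> first i x}"
      by (simp add: bij_betw_same_card)
    also have "real \<dots> = (\<Sum>i\<in>{1..n}. if x i \<in> G \<and> first i x then 1 else 0)"
      by (simp add: sum.If_cases Int_def)
    finally show ?thesis .
  qed
  then have eq: "(\<lambda>\<omega>. scan_stat n \<omega> G) = (\<lambda>\<omega>. (\<Sum>i\<in>{1..n}. snd \<omega> i * indicator G (fst \<omega> i))
      - (\<Sum>i\<in>{1..n}. if fst \<omega> i \<in> G \<and> first i (fst \<omega>) then 1 else 0) / 2)"
    by (auto simp: scan_stat_def split: prod.splits)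
  have [measurable]: "(\<lambda>\<omega>. fst \<omega> i) \<in> borel_measurable (sample_space n)"
    "(\<lambda>\<omega>. snd \<omega> i) \<in> borel_measurable (sample_space n)" if "i \<in> {1..n}" for i
    by (rule sample_space_components[OF that])+
  show ?thesis unfolding eq first_def by measurable
qed

definition rational_segments :: "real set set" where
  "rational_segments = (\<lambda>(a, b). {real_of_rat a..real_of_rat b}) ` UNIV"

lemma countable_rational_segments: "countable rational_segments"
  unfolding rational_segments_def by auto

text \<open>
  An endpoint can be moved outwards to a rational number without catching a new design point, because the
  points outside the segment lie at a positive distance. If the endpoint is 0 it is already rational, so the
  segment does not leave \<open>[0, 1]\<close>.
\<close>
lemma rational_below:
  fixes x :: "nat \<Rightarrow> real"
  assumes "0 \<le> a" "finite I"
  obtains q where "q \<in> \<rat>" "0 \<le> q" "q \<le> a" "\<And>i. i \<in> I \<Longrightarrow> x i < a \<Longrightarrow> x i < q"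
proof (cases "a = 0")
  case True
  then show ?thesis using that[of 0] by auto
next
  case False
  define m where "m = Max (insert 0 {x i | i. i \<in> I \<and> x i < a})"
  have fin: "finite (insert 0 {x i | i. i \<in> I \<and> x i < a})" using assms by auto
  have "m \<in> insert 0 {x i | i. i \<in> I \<and> x i < a}" unfolding m_def by (rule Max_in[OF fin]) auto
  then have "m < a" using False assms by auto
  have "0 \<le> m" unfolding m_def by (rule Max_ge[OF fin]) auto
  have m: "x i \<le> m" if "i \<in> I" "x i < a" for i
    unfolding m_def by (rule Max_ge[OF fin]) (use that in auto)
  obtain q where "q \<in> \<rat>" "m < q" "q < a" using Rats_dense_in_real[OF \<open>m < a\<close>] by auto
  then show ?thesis using that[of q] \<open>0 \<le> m\<close> m by force
qed

text \<open>
  Enlarging keeps a long segment long. The right endpoint is treated by the reflection \<open>z \<mapsto> 1 - z\<close>.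
\<close>
lemma rational_segment_same_hits:
  assumes "G \<in> long_members segments h"
  obtains G' where "G' \<in> long_members segments h" "G' \<in> rational_segments" "hits n G' x = hits n G x"
proof -
  obtain a b where G: "G = {a..b}" "0 \<le> a" "a \<le> b" "b \<le> 1" "h \<le> b - a"
    using assms by (auto simp: long_members_segments)
  obtain p where p: "p \<in> \<rat>" "0 \<le> p" "p \<le> a" "\<And>i. i \<in> {1..n} \<Longrightarrow> x i < a \<Longrightarrow> x i < p"
    using rational_below[of a "{1..n}" x] G by auto
  obtain r where r: "r \<in> \<rat>" "0 \<le> r" "r \<le> 1 - b" "\<And>i. i \<in> {1..n} \<Longrightarrow> 1 - x i < 1 - b \<Longrightarrow> 1 - x i < r"
    using rational_below[of "1 - b" "{1..n}" "\<lambda>i. 1 - x i"] G by auto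
  have "1 - r \<in> \<rat>" using r by simp
  then obtain p' r' where "p = real_of_rat p'" "1 - r = real_of_rat r'" using p by (auto elim!: Rats_cases)
  then have "{p..1 - r} \<in> rational_segments" unfolding rational_segments_def by force
  moreover have "{p..1 - r} \<in> long_members segments h"
    unfolding long_members_segments using p r G by (intro exI[of _ p] exI[of _ "1 - r"]) auto
  moreover have "hits n {p..1 - r} x = hits n G x"
    unfolding hits_def G using p(3,4) r(3,4) by (auto simp: not_le[symmetric]) (force simp: not_less)+
  ultimately show ?thesis using that by blast
qed

lemma scan_stat_cong_hits:
  assumes "hits n G x = hits n G' x"
  shows "scan_stat n (x, y) G = scan_stat n (x, y) G'"
proof -
  have "x i \<in> G \<longleftrightarrow> x i \<in> G'" if "i \<in> {1..n}" for i
  proof -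
    have "i \<in> hits n G x \<longleftrightarrow> i \<in> hits n G' x" using assms by simp
    then show ?thesis using that by (simp add: hits_def)
  qed
  note iff = this
  have "(\<Sum>i\<in>{1..n}. y i * indicator G (x i)) = (\<Sum>i\<in>{1..n}. y i * indicator G' (x i))"
    using iff by (intro sum.cong refl) (simp add: indicator_def)
  moreover have "x ` {1..n} \<inter> G = x ` {1..n} \<inter> G'"
    using iff by blast
  ultimately show ?thesis by (simp add: scan_stat_def)
qed

lemma finite_scan_stat_range: "finite (scan_stat n \<omega> ` A)"
proof -
  obtain x y where \<omega>: "\<omega> = (x, y)" by (cases \<omega>)
  have "scan_stat n \<omega> ` A \<subseteq> (\<lambda>I. scan_stat n \<omega> (SOME G. hits n G x = I)) ` Pow {1..n}"
  proof
    fix s assume "s \<in> scan_stat n \<omega> ` A"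
    then obtain G where G: "s = scan_stat n \<omega> G" by auto
    have "hits n (SOME G'. hits n G' x = hits n G x) x = hits n G x" by (rule someI) (rule refl)
    then have "s = scan_stat n \<omega> (SOME G'. hits n G' x = hits n G x)"
      unfolding G \<omega> by (intro scan_stat_cong_hits) simp
    then show "s \<in> (\<lambda>I. scan_stat n \<omega> (SOME G. hits n G x = I)) ` Pow {1..n}"
      using hits_subset by blast
  qed
  then show ?thesis by (rule finite_subset) simp
qed

text \<open>
  The scan statistic takes finitely many values, so its supremum over the uncountable class is attained.
\<close>
lemma test1_eq:
  assumes "h < 1"
  shows "test1 n h \<omega> = (if \<exists>G\<in>long_members segments h. 0 \<le> scan_stat n \<omega> G then 1 else 0)"
proof -
  have "{0..1} \<in> long_members segments h" using assms by (auto simp: long_members_segments)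
  then have ne: "scan_stat n \<omega> ` long_members segments h \<noteq> {}" by auto
  have "(SUP G\<in>long_members segments h. scan_stat n \<omega> G) = Max (scan_stat n \<omega> ` long_members segments h)"
    by (rule cSup_eq_Max[OF finite_scan_stat_range ne])
  then show ?thesis
    unfolding test1_def using Max_ge_iff[OF finite_scan_stat_range ne] by auto
qed

text \<open>
  Segments with rational endpoints suffice, so the rejection region is a countable union.
\<close>
lemma test1_is_test:
  assumes "h < 1"
  shows "is_test n (test1 n h)"
proof -
  have eq: "test1 n h = (\<lambda>\<omega>. if \<exists>G\<in>long_members segments h \<inter> rational_segments. 0 \<le> scan_stat n \<omega> G then 1 else 0)"
  proof
    fix \<omega> :: sample
    obtain x y where \<omega>: "\<omega> = (x, y)" by (cases \<omega>)
    have "(\<exists>G\<in>long_members segments h. 0 \<le> scan_stat n \<omega> G) \<longleftrightarrow>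
        (\<exists>G\<in>long_members segments h \<inter> rational_segments. 0 \<le> scan_stat n \<omega> G)"
    proof
      assume "\<exists>G\<in>long_members segments h. 0 \<le> scan_stat n \<omega> G"
      then obtain G where G: "G \<in> long_members segments h" "0 \<le> scan_stat n \<omega> G" by auto
      obtain G' where "G' \<in> long_members segments h" "G' \<in> rational_segments" "hits n G' x = hits n G x"
        using rational_segment_same_hits[OF G(1)] by metis
      then show "\<exists>G\<in>long_members segments h \<inter> rational_segments. 0 \<le> scan_stat n \<omega> G"
        using G(2) scan_stat_cong_hits[of n G' x G y] unfolding \<omega> by (intro bexI[of _ G']) auto
    qed auto
    then show "test1 n h \<omega> = (if \<exists>G\<in>long_members segments h \<inter> rational_segments. 0 \<le> scan_stat n \<omega> G then 1 else 0)"
      unfolding test1_eq[OF assms] by simp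
  qed
  have "countable (long_members segments h \<inter> rational_segments)"
    using countable_rational_segments by auto
  moreover have "Measurable.pred (sample_space n) (\<lambda>\<omega>. 0 \<le> scan_stat n \<omega> G)"
    if "G \<in> long_members segments h \<inter> rational_segments" for G
  proof -
    have [measurable]: "G \<in> sets borel" using that by (auto simp: long_members_segments)
    show ?thesis by measurable
  qed
  ultimately have "(\<Union>G\<in>long_members segments h \<inter> rational_segments. {\<omega> \<in> space (sample_space n). 0 \<le> scan_stat n \<omega> G})
      \<in> sets (sample_space n)"
    by (intro sets.countable_UN') (auto simp: pred_def)
  also have "(\<Union>G\<in>long_members segments h \<inter> rational_segments. {\<omega> \<in> space (sample_space n). 0 \<le> scan_stat n \<omega> G})
      = {\<omega> \<in> space (sample_space n). \<exists>G\<in>long_members segments h \<inter> rational_segments. 0 \<le> scan_stat n \<omega> G}"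
    by blast
  finally have "Measurable.pred (sample_space n) (\<lambda>\<omega>. \<exists>G\<in>long_members segments h \<inter> rational_segments. 0 \<le> scan_stat n \<omega> G)"
    unfolding pred_def .
  then show ?thesis unfolding eq by (rule is_test_indicator)
qed

section \<open>The law of the observations\<close>

definition noise_vector :: "real measure \<Rightarrow> nat \<Rightarrow> (nat \<Rightarrow> real) measure" where
  "noise_vector \<nu> n = (\<Pi>\<^sub>M i\<in>{1..n}. \<nu>)"

definition observe :: "nat \<Rightarrow> real set \<Rightarrow> (nat \<Rightarrow> real) \<Rightarrow> (nat \<Rightarrow> real) \<Rightarrow> sample" where
  "observe n G x \<xi> = (x, \<lambda>i\<in>{1..n}. indicator G (x i) + \<xi> i)"

locale regression = design: spread_design n "D n" + noise: prob_space \<nu>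
  for D :: "nat \<Rightarrow> (nat \<Rightarrow> real) measure" and n :: nat and \<nu> :: "real measure" +
  assumes sets_noise [measurable_cong]: "sets \<nu> = sets borel"
begin

lemma space_noise [simp]: "space \<nu> = UNIV"
  using sets_eq_imp_space_eq[OF sets_noise] by simp

lemma sets_noise_vector [measurable_cong]: "sets (noise_vector \<nu> n) = sets (vec_space n)"
  unfolding vec_space_def noise_vector_def by (intro sets_PiM_cong) (auto simp: sets_noise)

lemma space_noise_vector: "space (noise_vector \<nu> n) = space (vec_space n)"
  by (rule sets_eq_imp_space_eq[OF sets_noise_vector])

lemmas sets_design_vec [measurable_cong] = design.sets_design

lemma space_design: "space (D n) = space (vec_space n)"
  by (rule sets_eq_imp_space_eq[OF sets_design_vec])

lemma prob_space_noise_vector: "prob_space (noise_vector \<nu> n)"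
  unfolding noise_vector_def by (rule prob_space_PiM) (rule noise.prob_space_axioms)

lemma product_noise: "product_sigma_finite (\<lambda>_::nat. \<nu>)"
  unfolding product_sigma_finite_def using noise.sigma_finite_measure_axioms by simp

lemma sets_joint [measurable_cong]: "sets (D n \<Otimes>\<^sub>M noise_vector \<nu> n) = sets (sample_space n)"
  unfolding sample_space_def by (intro sets_pair_measure_cong sets_design_vec sets_noise_vector)

lemma observe_measurable:
  assumes [measurable]: "G \<in> sets borel"
  shows "(\<lambda>(x, \<xi>). observe n G x \<xi>) \<in> D n \<Otimes>\<^sub>M noise_vector \<nu> n \<rightarrow>\<^sub>M sample_space n"
proof -
  have [measurable]: "(\<lambda>\<omega>. snd \<omega> i) \<in> borel_measurable (D n \<Otimes>\<^sub>M noise_vector \<nu> n)"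
    "(\<lambda>\<omega>. fst \<omega> i) \<in> borel_measurable (D n \<Otimes>\<^sub>M noise_vector \<nu> n)" if "i \<in> {1..n}" for i
    unfolding measurable_cong_sets[OF sets_joint refl]
    using sample_space_components[OF that] by auto
  have "(\<lambda>\<omega>. \<lambda>i\<in>{1..n}. indicator G (fst \<omega> i) + snd \<omega> i) \<in> D n \<Otimes>\<^sub>M noise_vector \<nu> n \<rightarrow>\<^sub>M vec_space n"
    unfolding vec_space_def by (rule measurable_restrict) measurable
  moreover have "fst \<in> D n \<Otimes>\<^sub>M noise_vector \<nu> n \<rightarrow>\<^sub>M vec_space n"
    unfolding measurable_cong_sets[OF sets_joint refl] by measurable
  ultimately show ?thesis
    unfolding sample_space_def observe_def split_beta by (rule measurable_Pair[rotated])
qed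

lemma obs_law_eq:
  "obs_law D \<nu> n G = distr (D n \<Otimes>\<^sub>M noise_vector \<nu> n) (sample_space n) (\<lambda>(x, \<xi>). observe n G x \<xi>)"
  by (simp add: obs_law_def observe_def noise_vector_def)

lemma prob_space_obs_law:
  assumes "G \<in> sets borel"
  shows "prob_space (obs_law D \<nu> n G)"
proof -
  interpret N: prob_space "noise_vector \<nu> n" by (rule prob_space_noise_vector)
  interpret pair_prob_space "D n" "noise_vector \<nu> n" ..
  show ?thesis unfolding obs_law_eq
    by (rule prob_space_distr[OF observe_measurable[OF assms]])
qed

lemma emeasure_obs_law:
  assumes G: "G \<in> sets borel" and A: "A \<in> sets (sample_space n)"
  shows "emeasure (obs_law D \<nu> n G) A =
    (\<integral>\<^sup>+x. emeasure (noise_vector \<nu> n) {\<xi> \<in> space (vec_space n). observe n G x \<xi> \<in> A} \<partial>(D n))"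
proof -
  interpret N: prob_space "noise_vector \<nu> n" by (rule prob_space_noise_vector)
  let ?B = "(\<lambda>(x, \<xi>). observe n G x \<xi>) -` A \<inter> space (D n \<Otimes>\<^sub>M noise_vector \<nu> n)"
  have "?B \<in> sets (D n \<Otimes>\<^sub>M noise_vector \<nu> n)"
    by (rule measurable_sets[OF observe_measurable[OF G] A])
  then have "emeasure (obs_law D \<nu> n G) A = (\<integral>\<^sup>+x. emeasure (noise_vector \<nu> n) (Pair x -` ?B) \<partial>(D n))"
    unfolding obs_law_eq emeasure_distr[OF observe_measurable[OF G] A]
    by (rule N.emeasure_pair_measure_alt)
  also have "\<dots> = (\<integral>\<^sup>+x. emeasure (noise_vector \<nu> n) {\<xi> \<in> space (vec_space n). observe n G x \<xi> \<in> A} \<partial>(D n))"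
    by (intro nn_integral_cong arg_cong[where f="emeasure _"])
       (auto simp: space_pair_measure space_noise_vector)
  finally show ?thesis .
qed

text \<open>
  Design and noise are independent, so an error probability is bounded by bounding it for
  a fixed design and averaging the bound over the design.
\<close>
lemma obs_law_le_integral:
  assumes G: "G \<in> sets borel" and A: "A \<in> sets (sample_space n)"
    and f: "integrable (D n) f" "\<And>x. 0 \<le> f x"
    and le: "AE x in (D n). measure (noise_vector \<nu> n) {\<xi> \<in> space (vec_space n). observe n G x \<xi> \<in> A} \<le> f x"
  shows "measure (obs_law D \<nu> n G) A \<le> (\<integral>x. f x \<partial>(D n))"
proof -
  interpret N: prob_space "noise_vector \<nu> n" by (rule prob_space_noise_vector)
  interpret L: prob_space "obs_law D \<nu> n G" by (rule prob_space_obs_law[OF G])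
  have "emeasure (obs_law D \<nu> n G) A \<le> (\<integral>\<^sup>+x. ennreal (f x) \<partial>(D n))"
    unfolding emeasure_obs_law[OF G A]
  proof (rule nn_integral_mono_AE)
    show "AE x in D n. emeasure (noise_vector \<nu> n) {\<xi> \<in> space (vec_space n). observe n G x \<xi> \<in> A} \<le> ennreal (f x)"
      using le by eventually_elim (simp add: N.emeasure_eq_measure ennreal_leI)
  qed
  also have "\<dots> = ennreal (\<integral>x. f x \<partial>(D n))"
    using f by (intro nn_integral_eq_integral) auto
  finally show ?thesis
    using f by (simp add: L.emeasure_eq_measure integral_nonneg_AE)
qed

text \<open>
  Markov's inequality for the exponential of the sum, whose expectation factorises. The value \<open>card I = 0\<close> is covered:
  then the bound is 1, which is how samples with no design point in the segment are accounted for.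
\<close>
lemma noise_chernoff:
  assumes I: "I \<subseteq> {1..n}" and [measurable]: "g \<in> borel_measurable borel"
    and int: "integrable \<nu> (\<lambda>z. exp (g z))"
    and A: "A \<subseteq> {\<xi> \<in> space (vec_space n). 0 \<le> (\<Sum>i\<in>I. g (\<xi> i))}"
  shows "measure (noise_vector \<nu> n) A \<le> (\<integral>z. exp (g z) \<partial>\<nu>) ^ card I"
proof -
  interpret N: prob_space "noise_vector \<nu> n" by (rule prob_space_noise_vector)
  interpret product_sigma_finite "\<lambda>_::nat. \<nu>" by (rule product_noise)
  have fin: "finite I" using I by (rule finite_subset) simp
  let ?E = "{\<xi> \<in> space (noise_vector \<nu> n). 0 \<le> (\<Sum>i\<in>I. g (\<xi> i))}"
  have [measurable]: "(\<lambda>\<xi>. g (\<xi> i)) \<in> borel_measurable (noise_vector \<nu> n)" if "i \<in> I" for i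
    using that I unfolding measurable_cong_sets[OF sets_noise_vector refl] 
    by (intro measurable_compose[OF vec_space_component]) auto
  have E: "?E \<in> sets (noise_vector \<nu> n)" by measurable
  have prod: "(\<Prod>i\<in>{1..n}. if i \<in> I then c else 1) = c ^ card I" for c :: ennreal
    using I fin by (simp add: prod.If_cases Int_absorb1)
  have "emeasure (noise_vector \<nu> n) ?E = (\<integral>\<^sup>+\<xi>. indicator ?E \<xi> \<partial>noise_vector \<nu> n)"
    using E by simp
  also have "\<dots> \<le> (\<integral>\<^sup>+\<xi>. (\<Prod>i\<in>{1..n}. if i \<in> I then ennreal (exp (g (\<xi> i))) else 1) \<partial>noise_vector \<nu> n)"
  proof (rule nn_integral_mono)
    fix \<xi>
    have "(\<Prod>i\<in>{1..n}. if i \<in> I then ennreal (exp (g (\<xi> i))) else 1) = (\<Prod>i\<in>I. ennreal (exp (g (\<xi> i))))"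
      using I fin by (simp add: prod.If_cases Int_absorb1)
    also have "\<dots> = ennreal (exp (\<Sum>i\<in>I. g (\<xi> i)))"
      using fin by (simp add: prod_ennreal exp_sum)
    also have "indicator ?E \<xi> \<le> \<dots>" by (auto simp: indicator_def)
    finally show "indicator ?E \<xi> \<le> (\<Prod>i\<in>{1..n}. if i \<in> I then ennreal (exp (g (\<xi> i))) else 1)" .
  qed
  also have "\<dots> = (\<Prod>i\<in>{1..n}. \<integral>\<^sup>+z. (if i \<in> I then ennreal (exp (g z)) else 1) \<partial>\<nu>)"
    unfolding noise_vector_def by (rule product_nn_integral_prod) (auto simp: measurable_cong_sets[OF sets_noise refl])
  also have "\<dots> = (\<Prod>i\<in>{1..n}. if i \<in> I then \<integral>\<^sup>+z. ennreal (exp (g z)) \<partial>\<nu> else 1)"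
    by (intro prod.cong refl) (simp add: noise.emeasure_space_1[simplified])
  also have "\<dots> = (\<integral>\<^sup>+z. ennreal (exp (g z)) \<partial>\<nu>) ^ card I" by (rule prod)
  also have "\<dots> = ennreal ((\<integral>z. exp (g z) \<partial>\<nu>) ^ card I)"
    using int by (simp add: nn_integral_eq_integral ennreal_power integral_nonneg_AE)
  finally have "measure (noise_vector \<nu> n) ?E \<le> (\<integral>z. exp (g z) \<partial>\<nu>) ^ card I"
    by (simp add: N.emeasure_eq_measure integral_nonneg_AE)
  moreover have "measure (noise_vector \<nu> n) A \<le> measure (noise_vector \<nu> n) ?E"
    using A E by (intro N.finite_measure_mono) (auto simp: space_noise_vector)
  ultimately show ?thesis by linarith
qed

lemma exp_hits_integrable:
  assumes [measurable]: "G \<in> sets borel"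
  shows "integrable (D n) (\<lambda>x. exp (\<kappa> * real (card (hits n G x))))"
proof (rule design.integrable_const_bound[where B="exp (\<bar>\<kappa>\<bar> * real n)"])
  show "(\<lambda>x. exp (\<kappa> * real (card (hits n G x)))) \<in> borel_measurable (D n)"
    unfolding measurable_cong_sets[OF sets_design_vec refl] by measurable
  have "\<kappa> * real (card (hits n G x)) \<le> \<bar>\<kappa>\<bar> * real n" for x
  proof -
    have "card (hits n G x) \<le> n" using card_mono[OF _ hits_subset, of n G x] by simp
    then show ?thesis by (intro mult_mono) auto
  qed
  then show "AE x in (D n). norm (exp (\<kappa> * real (card (hits n G x)))) \<le> exp (\<bar>\<kappa>\<bar> * real n)"
    by simp
qed

lemma test_risk_ge:
  assumes G: "G \<in> long_members C h" and C: "C \<subseteq> sets borel"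
  shows "measure (obs_law D \<nu> n {}) {\<omega> \<in> space (sample_space n). \<tau> \<omega> = 1}
      + measure (obs_law D \<nu> n G) {\<omega> \<in> space (sample_space n). \<tau> \<omega> = 0} \<le> test_risk D \<nu> n h \<tau> C"
proof -
  have "measure (obs_law D \<nu> n G) A \<le> 1" if "G \<in> long_members C h" for G A
  proof -
    interpret L: prob_space "obs_law D \<nu> n G"
      using that C by (intro prob_space_obs_law) (auto simp: long_members_def)
    show ?thesis by simp
  qed
  then have "bdd_above ((\<lambda>G. measure (obs_law D \<nu> n G) {\<omega> \<in> space (sample_space n). \<tau> \<omega> = 0}) ` long_members C h)"
    by (intro bdd_aboveI[of _ 1]) auto
  then show ?thesis unfolding test_risk_def by (intro add_left_mono cSUP_upper[OF G])
qed

end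

lemma test_risk_le:
  assumes "measure (obs_law D \<nu> n {}) {\<omega> \<in> space (sample_space n). \<tau> \<omega> = 1} \<le> \<alpha>"
    and "\<And>G. G \<in> long_members C h \<Longrightarrow>
      measure (obs_law D \<nu> n G) {\<omega> \<in> space (sample_space n). \<tau> \<omega> = 0} \<le> \<beta>"
    and "long_members C h \<noteq> {}"
  shows "test_risk D \<nu> n h \<tau> C \<le> \<alpha> + \<beta>"
  unfolding test_risk_def using assms by (intro add_mono cSUP_least) auto

lemma is_test_sets:
  assumes "is_test n \<tau>"
  shows "{\<omega> \<in> space (sample_space n). \<tau> \<omega> = 1} \<in> sets (sample_space n)"
    "{\<omega> \<in> space (sample_space n). \<tau> \<omega> = 0} \<in> sets (sample_space n)"
  using measurable_sets[OF assms[unfolded is_test_def], of "{1}"]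
    measurable_sets[OF assms[unfolded is_test_def], of "{0}"]
  by (auto simp: vimage_def Int_def conj_commute)

section \<open>Consistency of the test for initial segments\<close>

text \<open>
  The function is the moment generating function of \<open>c - B\<close> with \<open>B\<close> Bernoulli of mean \<open>p\<close>. It equals 1 at \<open>u = 0\<close> and has
  derivative \<open>c - p < 0\<close> there.
\<close>
lemma small_exponential_tilt:
  fixes c p :: real
  assumes "c < p"
  obtains u where "0 < u" "exp (u * (c - 1)) * p + exp (u * c) * (1 - p) < 1"
proof -
  let ?\<phi> = "\<lambda>u. exp (u * (c - 1)) * p + exp (u * c) * (1 - p)"
  have "(?\<phi> has_real_derivative (c - p)) (at 0)"
    by (auto intro!: derivative_eq_intros simp: algebra_simps)
  then obtain d where d: "0 < d" "\<And>u. 0 < u \<Longrightarrow> u < d \<Longrightarrow> ?\<phi> (0 + u) < ?\<phi> 0"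
    using DERIV_neg_dec_right[of ?\<phi> "c - p" 0] assms by auto
  show ?thesis using that[of "d / 2"] d(1) d(2)[of "d / 2"] by simp
qed

lemma sum_two_valued_eq_card:
  fixes a b :: real
  assumes fin: "finite I"
  shows "(\<Sum>i\<in>I. if Q i then a else b)
    = a * real (card {i \<in> I. Q i}) + b * (real (card I) - real (card {i \<in> I. Q i}))"
proof -
  have "real (card I) = real (card {i \<in> I. Q i}) + real (card {i \<in> I. \<not> Q i})"
  proof -
    have "card I = card ({i \<in> I. Q i} \<union> {i \<in> I. \<not> Q i})"
      by (intro arg_cong[where f=card]) auto
    also have "\<dots> = card {i \<in> I. Q i} + card {i \<in> I. \<not> Q i}"
      using fin by (intro card_Un_disjoint) auto
    finally show ?thesis by simp
  qed
  then show ?thesis using fin by (simp add: sum.If_cases Int_def conj_commute)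
qed

text \<open>
  For an ordered nonnegative design, the points in \<open>[0, h]\<close> are those up to the last index used by the test;
  if there are none, the default value 0 of the last index gives the empty interval.
\<close>
lemma hits_initial:
  assumes "strict_mono_on {1..n} x" "\<forall>i\<in>{1..n}. 0 \<le> x i"
  shows "hits n {0..h} x = {1..last_index n h x}"
proof (cases "\<exists>i\<in>{1..n}. x i \<le> h")
  case True
  let ?S = "{i \<in> {1..n}. x i \<le> h}"
  have S: "finite ?S" "?S \<noteq> {}" using True by auto
  have L: "last_index n h x = Max ?S" using True by (simp only: last_index_def if_True)
  have l: "last_index n h x \<in> {1..n}" "x (last_index n h x) \<le> h"
    using Max_in[OF S] unfolding L by blast+
  have upper: "i \<le> last_index n h x" if "i \<in> ?S" for i unfolding L by (rule Max_ge[OF S(1) that])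
  have lower: "x i \<le> h" if "1 \<le> i" "i \<le> last_index n h x" for i
  proof -
    have "x i \<le> x (last_index n h x)"
      using that l strict_mono_onD[OF assms(1), of i "last_index n h x"] by (cases "i = last_index n h x") auto
    then show ?thesis using l by linarith
  qed
  show ?thesis
  proof (intro set_eqI iffI)
    fix i assume "i \<in> hits n {0..h} x"
    then have "i \<in> ?S" by (simp add: hits_def)
    then show "i \<in> {1..last_index n h x}" using upper[of i] by simp
  next
    fix i assume i: "i \<in> {1..last_index n h x}"
    then have "i \<in> {1..n}" using l by simp
    then show "i \<in> hits n {0..h} x" using lower[of i] i assms(2) by (simp add: hits_def)
  qed
next
  case False
  then have "last_index n h x = 0" by (simp only: last_index_def if_False)
  then show ?thesis using False by (auto simp: hits_def)
qed

context regression
begin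

text \<open>
  The event is stated through counts because \<open>test0\<close> compares a count with a threshold; the expression is the sum of
  the two-valued variables that equal \<open>a\<close> on \<open>B\<close> and \<open>b\<close> off \<open>B\<close>.
\<close>
lemma sum_indicator_chernoff:
  assumes B: "B \<in> sets borel" and I: "I \<subseteq> {1..n}"
    and A: "\<And>\<xi>. \<xi> \<in> A \<Longrightarrow> \<xi> \<in> space (vec_space n) \<and>
      0 \<le> a * real (card {i \<in> I. \<xi> i \<in> B}) + b * (real (card I) - real (card {i \<in> I. \<xi> i \<in> B}))"
  shows "measure (noise_vector \<nu> n) A \<le> (exp a * measure \<nu> B + exp b * (1 - measure \<nu> B)) ^ card I"
proof -
  let ?g = "\<lambda>z. if z \<in> B then a else b"
  have fin: "finite I" using I by (rule finite_subset) simp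
  have B': "B \<in> sets \<nu>" using B sets_noise by simp
  have eq: "exp (?g z) = exp b + (exp a - exp b) * indicator B z" for z by (auto simp: indicator_def)
  have int: "integrable \<nu> (indicator B :: real \<Rightarrow> real)"
    using B' by (simp add: noise.emeasure_eq_measure)
  have "measure (noise_vector \<nu> n) A \<le> (\<integral>z. exp (?g z) \<partial>\<nu>) ^ card I"
  proof (rule noise_chernoff[OF I])
    show "?g \<in> borel_measurable borel" using B by measurable
    show "integrable \<nu> (\<lambda>z. exp (?g z))" unfolding eq using int by simp
    show "A \<subseteq> {\<xi> \<in> space (vec_space n). 0 \<le> (\<Sum>i\<in>I. ?g (\<xi> i))}"
      using A by (auto simp: sum_two_valued_eq_card[OF fin])
  qed
  also have "(\<integral>z. exp (?g z) \<partial>\<nu>) = exp a * measure \<nu> B + exp b * (1 - measure \<nu> B)"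
    unfolding eq using int B' by (simp add: noise.prob_space[simplified] algebra_simps)
  finally show ?thesis .
qed

lemma power_hits_bound:
  assumes DG: "G \<in> sets borel" and A: "A \<in> sets (sample_space n)" and r: "0 < r" "r < 1"
    and t: "0 \<le> t" "t \<le> 1"
    and le: "AE x in D n. measure (noise_vector \<nu> n) {\<xi> \<in> space (vec_space n). observe n G x \<xi> \<in> A}
      \<le> r ^ card (hits n {0..t} x)"
  shows "measure (obs_law D \<nu> n G) A \<le> exp (\<bar>ln r\<bar> + (r - 1) * (real n * t))"
proof -
  have r': "r ^ k = exp (ln r * real k)" for k
    using r by (simp add: exp_of_nat2_mult)
  have "measure (obs_law D \<nu> n G) A \<le> (\<integral>x. exp (ln r * real (card (hits n {0..t} x))) \<partial>D n)"
    by (rule obs_law_le_integral[OF DG A exp_hits_integrable]) (use le in \<open>auto simp: r'\<close>)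
  also have "\<dots> \<le> exp (\<bar>ln r\<bar> + (exp (ln r) - 1) * (real n * (t - 0)))"
    using t by (intro design.exp_hits_le) auto
  finally show ?thesis using r by simp
qed

text \<open>
  Under the null hypothesis \<open>Y = \<xi>\<close>, and rejection means that the sum of the variables \<open>c - 1(\<xi> \<le> 1/2)\<close> over the
  design points in \<open>[0, h]\<close> is nonnegative; \<open>r\<close> is their moment generating function at \<open>u\<close>.
\<close>
lemma test0_level:
  fixes c h u :: real
  assumes h: "0 < h" "h < 1" and u: "0 < u"
  defines "p \<equiv> measure \<nu> {x. x \<le> 1 / 2}"
  defines "r \<equiv> exp (u * (c - 1)) * p + exp (u * c) * (1 - p)"
  assumes r: "r < 1"
  shows "measure (obs_law D \<nu> n {}) {\<omega> \<in> space (sample_space n). test0 c n h \<omega> = 1}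
    \<le> exp (\<bar>ln r\<bar> + (r - 1) * (real n * h))"
proof (rule power_hits_bound)
  show "{\<omega> \<in> space (sample_space n). test0 c n h \<omega> = 1} \<in> sets (sample_space n)"
    by (rule is_test_sets[OF test0_is_test])
  have "0 \<le> p" "p \<le> 1" by (auto simp: p_def)
  then show "0 < r" unfolding r_def by (cases "p = 0") (auto intro: add_pos_nonneg)
  show "AE x in D n. measure (noise_vector \<nu> n) {\<xi> \<in> space (vec_space n).
      observe n {} x \<xi> \<in> {\<omega> \<in> space (sample_space n). test0 c n h \<omega> = 1}} \<le> r ^ card (hits n {0..h} x)"
    using design.design_strict_mono design.design_nonneg
  proof eventually_elim
    case (elim x)
    let ?N = "last_index n h x"
    have I: "{1..?N} \<subseteq> {1..n}" using last_index_le[of n h x] by auto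
    have S: "{i \<in> {1..?N}. (\<lambda>i\<in>{1..n}. indicator {} (x i) + \<xi> i) i \<le> 1 / 2} = {i \<in> {1..?N}. \<xi> i \<in> {x. x \<le> 1 / 2}}" for \<xi> :: "nat \<Rightarrow> real"
      using last_index_le[of n h x] by auto
    show ?case unfolding hits_initial[OF elim] r_def p_def
    proof (rule sum_indicator_chernoff[OF _ I])
      fix \<xi> assume "\<xi> \<in> {\<xi> \<in> space (vec_space n). observe n {} x \<xi> \<in> {\<omega> \<in> space (sample_space n). test0 c n h \<omega> = 1}}"
      then have \<xi>: "\<xi> \<in> space (vec_space n)" "test0 c n h (observe n {} x \<xi>) = 1" by auto
      define s where "s = real (card {i \<in> {1..?N}. \<xi> i \<in> {x. x \<le> 1 / 2}})"
      have "s \<le> c * real ?N"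
        using \<xi>(2) unfolding test0_def observe_def s_def by (simp only: Let_def prod.case S split: if_splits)
      then have "0 \<le> u * (c * real ?N - s)" using u by simp
      then show "\<xi> \<in> space (vec_space n) \<and> 0 \<le> u * (c - 1) * real (card {i \<in> {1..?N}. \<xi> i \<in> {x. x \<le> 1 / 2}}) +
          u * c * (real (card {1..?N}) - real (card {i \<in> {1..?N}. \<xi> i \<in> {x. x \<le> 1 / 2}}))"
        using \<xi>(1) unfolding s_def[symmetric] by (simp add: algebra_simps)
    qed auto
  qed
qed (use h r in auto)

text \<open>
  If the true set contains \<open>[0, h]\<close>, then \<open>Y = 1 + \<xi>\<close> for all indices in use, so \<open>Y \<le> 1/2\<close> means \<open>\<xi> \<le> - 1/2\<close>.
  Acceptance means that the sum of \<open>1(\<xi> \<le> - 1/2) - c\<close> is positive, i.e. that the Bernoulli variables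
  \<open>1(\<xi> > - 1/2)\<close> average to less than \<open>1 - c\<close>; hence the complemented parameters in \<open>r\<close>.
\<close>
lemma test0_power:
  fixes c h t u :: real
  assumes h: "0 < h" and t: "h \<le> t" "t \<le> 1" and u: "0 < u"
  defines "p \<equiv> 1 - measure \<nu> {x. x \<le> - 1 / 2}"
  defines "r \<equiv> exp (u * ((1 - c) - 1)) * p + exp (u * (1 - c)) * (1 - p)"
  assumes r: "r < 1"
  shows "measure (obs_law D \<nu> n {0..t}) {\<omega> \<in> space (sample_space n). test0 c n h \<omega> = 0}
    \<le> exp (\<bar>ln r\<bar> + (r - 1) * (real n * h))"
proof (rule power_hits_bound)
  show "{\<omega> \<in> space (sample_space n). test0 c n h \<omega> = 0} \<in> sets (sample_space n)"
    by (rule is_test_sets[OF test0_is_test])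
  have "0 \<le> p" "p \<le> 1" by (auto simp: p_def)
  then show "0 < r" unfolding r_def by (cases "p = 0") (auto intro: add_pos_nonneg)
  have r_alt: "r = exp (u * (1 - c)) * measure \<nu> {x. x \<le> - 1 / 2} + exp (- u * c) * (1 - measure \<nu> {x. x \<le> - 1 / 2})"
    by (simp add: r_def p_def algebra_simps)
  show "AE x in D n. measure (noise_vector \<nu> n) {\<xi> \<in> space (vec_space n).
      observe n {0..t} x \<xi> \<in> {\<omega> \<in> space (sample_space n). test0 c n h \<omega> = 0}} \<le> r ^ card (hits n {0..h} x)"
    using design.design_strict_mono design.design_nonneg
  proof eventually_elim
    case (elim x)
    let ?N = "last_index n h x"
    have I: "{1..?N} \<subseteq> {1..n}" using last_index_le[of n h x] by auto
    have x: "x i \<in> {0..t}" if "i \<in> {1..?N}" for i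
    proof -
      have "i \<in> hits n {0..h} x" using that hits_initial[OF elim] by simp
      then show ?thesis using t by (auto simp: hits_def)
    qed
    have S: "{i \<in> {1..?N}. (\<lambda>i\<in>{1..n}. indicator {0..t} (x i) + \<xi> i) i \<le> 1 / 2} = {i \<in> {1..?N}. \<xi> i \<in> {x. x \<le> - 1 / 2}}" for \<xi> :: "nat \<Rightarrow> real"
    proof (rule Collect_cong, rule conj_cong[OF refl])
      fix i assume i: "i \<in> {1..?N}"
      then have "(\<lambda>i\<in>{1..n}. indicator {0..t} (x i) + \<xi> i) i = 1 + \<xi> i" using I x[OF i] by (simp add: subset_iff)
      then show "(\<lambda>i\<in>{1..n}. indicator {0..t} (x i) + \<xi> i) i \<le> 1 / 2 \<longleftrightarrow> \<xi> i \<in> {x. x \<le> - 1 / 2}"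
        unfolding mem_Collect_eq by linarith
    qed
    show ?case unfolding hits_initial[OF elim] r_alt
    proof (rule sum_indicator_chernoff[OF _ I])
      fix \<xi> assume "\<xi> \<in> {\<xi> \<in> space (vec_space n). observe n {0..t} x \<xi> \<in> {\<omega> \<in> space (sample_space n). test0 c n h \<omega> = 0}}"
      then have \<xi>: "\<xi> \<in> space (vec_space n)" "test0 c n h (observe n {0..t} x \<xi>) = 0" by auto
      define s where "s = real (card {i \<in> {1..?N}. \<xi> i \<in> {x. x \<le> - 1 / 2}})"
      have "\<not> s \<le> c * real ?N"
        using \<xi>(2) unfolding test0_def observe_def s_def by (simp only: Let_def prod.case S split: if_splits) simp
      then have "0 \<le> u * (s - c * real ?N)" using u by simp
      then show "\<xi> \<in> space (vec_space n) \<and> 0 \<le> u * (1 - c) * real (card {i \<in> {1..?N}. \<xi> i \<in> {x. x \<le> - 1 / 2}}) +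
          - u * c * (real (card {1..?N}) - real (card {i \<in> {1..?N}. \<xi> i \<in> {x. x \<le> - 1 / 2}}))"
        using \<xi>(1) unfolding s_def[symmetric] by (simp add: algebra_simps)
    qed auto
  qed
qed (use h t r in auto)

end

lemma consistent_testI:
  assumes "\<And>n. 1 \<le> n \<Longrightarrow> is_test n (\<tau> n)"
    and "\<forall>\<^sub>F n in sequentially. 0 \<le> test_risk D \<nu> n (h n) (\<tau> n) C"
    and "\<forall>\<^sub>F n in sequentially. test_risk D \<nu> n (h n) (\<tau> n) C \<le> b n"
    and "b \<longlonglongrightarrow> 0"
  shows "consistent_test D \<nu> h C \<tau>"
  unfolding consistent_test_def using assms tendsto_sandwich[OF assms(2,3) tendsto_const assms(4)] by blast

lemma test_risk_nonneg:
  assumes "regression D n \<nu>" "C \<subseteq> sets borel" "long_members C h \<noteq> {}"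
  shows "0 \<le> test_risk D \<nu> n h \<tau> C"
proof -
  obtain G where G: "G \<in> long_members C h" using assms(3) by auto
  have "0 \<le> measure (obs_law D \<nu> n {}) {\<omega> \<in> space (sample_space n). \<tau> \<omega> = 1}
      + measure (obs_law D \<nu> n G) {\<omega> \<in> space (sample_space n). \<tau> \<omega> = 0}" by simp
  also have "\<dots> \<le> test_risk D \<nu> n h \<tau> C" by (rule regression.test_risk_ge[OF assms(1) G assms(2)])
  finally show ?thesis .
qed

lemma segments_borel: "segments \<subseteq> sets borel" "segments0 \<subseteq> sets borel"
  by (auto simp: segments_def segments0_def)

lemma unit_interval_long_member:
  assumes "h < 1"
  shows "{0..1} \<in> long_members segments h" "{0..1} \<in> long_members segments0 h"
  using assms by (auto simp: long_members_segments long_members_segments0)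

text \<open>
  Both error probabilities are of the form \<open>exp (const - \<delta> * n * h)\<close> with \<open>\<delta> > 0\<close>, uniformly over the alternative.
\<close>
theorem test0_consistent:
  assumes reg: "\<And>n. 1 \<le> n \<Longrightarrow> regression D n \<nu>"
    and h: "\<forall>n\<ge>1. 0 < h n \<and> h n < 1"
    and lim: "filterlim (\<lambda>n. real n * h n) at_top sequentially"
    and c: "measure \<nu> {x. x \<le> - 1 / 2} < c" "c < measure \<nu> {x. x \<le> 1 / 2}"
  shows "consistent_test D \<nu> h segments0 (\<lambda>n. test0 c n (h n))"
proof -
  define p where "p = measure \<nu> {x. x \<le> 1 / 2}"
  define q where "q = 1 - measure \<nu> {x. x \<le> - 1 / 2}"
  obtain u where u: "0 < u" "exp (u * (c - 1)) * p + exp (u * c) * (1 - p) < 1"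
    using small_exponential_tilt[of c p] c by (auto simp: p_def)
  obtain v where v: "0 < v" "exp (v * ((1 - c) - 1)) * q + exp (v * (1 - c)) * (1 - q) < 1"
    using small_exponential_tilt[of "1 - c" q] c by (auto simp: q_def)
  define r where "r = exp (u * (c - 1)) * p + exp (u * c) * (1 - p)"
  define s where "s = exp (v * ((1 - c) - 1)) * q + exp (v * (1 - c)) * (1 - q)"
  have vanish: "(\<lambda>n. exp (k + (a - 1) * (real n * h n))) \<longlonglongrightarrow> 0" if "a < 1" for k a
  proof -
    have "filterlim (\<lambda>n. (a - 1) * (real n * h n)) at_bot sequentially"
      using that by (intro filterlim_tendsto_neg_mult_at_bot[OF tendsto_const _ lim]) auto
    then have "(\<lambda>n. exp ((a - 1) * (real n * h n))) \<longlonglongrightarrow> 0"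
      by (rule filterlim_compose[OF exp_at_bot])
    then show ?thesis unfolding exp_add by (rule tendsto_mult_right_zero)
  qed
  show ?thesis
  proof (rule consistent_testI)
    show "is_test n (test0 c n (h n))" for n by (rule test0_is_test)
    show "\<forall>\<^sub>F n in sequentially. 0 \<le> test_risk D \<nu> n (h n) (test0 c n (h n)) segments0"
      using eventually_ge_at_top[of 1]
    proof eventually_elim
      case (elim n)
      then show ?case using h unit_interval_long_member(2)[of "h n"]
        by (intro test_risk_nonneg[OF reg segments_borel(2)]) auto
    qed
    show "\<forall>\<^sub>F n in sequentially. test_risk D \<nu> n (h n) (test0 c n (h n)) segments0
        \<le> exp (\<bar>ln r\<bar> + (r - 1) * (real n * h n)) + exp (\<bar>ln s\<bar> + (s - 1) * (real n * h n))"
      using eventually_ge_at_top[of 1]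
    proof eventually_elim
      case (elim n)
      interpret regression D n \<nu> by (rule reg[OF elim])
      have hn: "0 < h n" "h n < 1" using h elim by auto
      show ?case
      proof (rule test_risk_le)
        show "measure (obs_law D \<nu> n {}) {\<omega> \<in> space (sample_space n). test0 c n (h n) \<omega> = 1}
            \<le> exp (\<bar>ln r\<bar> + (r - 1) * (real n * h n))"
          unfolding r_def p_def by (rule test0_level[OF hn u(1) u(2)[unfolded p_def]])
        show "long_members segments0 (h n) \<noteq> {}" using unit_interval_long_member(2)[of "h n"] hn by auto
        fix G assume "G \<in> long_members segments0 (h n)"
        then obtain t where t: "G = {0..t}" "h n \<le> t" "t \<le> 1" by (auto simp: long_members_segments0)
        show "measure (obs_law D \<nu> n G) {\<omega> \<in> space (sample_space n). test0 c n (h n) \<omega> = 0}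
            \<le> exp (\<bar>ln s\<bar> + (s - 1) * (real n * h n))"
          unfolding t(1) s_def q_def by (rule test0_power[OF hn(1) t(2,3) v(1) v(2)[unfolded q_def]])
      qed
    qed
    show "(\<lambda>n. exp (\<bar>ln r\<bar> + (r - 1) * (real n * h n)) + exp (\<bar>ln s\<bar> + (s - 1) * (real n * h n))) \<longlonglongrightarrow> 0"
      using tendsto_add[OF vanish[of r "\<bar>ln r\<bar>"] vanish[of s "\<bar>ln s\<bar>"]] u v by (simp add: r_def s_def)
  qed
qed

section \<open>Consistency of the scan test\<close>

text \<open>
  For an increasing design, a segment cuts out a set of consecutive indices. So all segments together produce at
  most \<open>n * (n + 1)\<close> index sets; the empty one is written as \<open>{1..0}\<close>.
\<close>
lemma strict_mono_hits_interval:
  fixes x :: "nat \<Rightarrow> real"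
  assumes x: "strict_mono_on {1..n} x" and n: "1 \<le> n"
  shows "hits n {a..b} x \<in> (\<lambda>(i, j). {i..j}) ` ({1..n} \<times> {0..n})"
proof (cases "hits n {a..b} x = {}")
  case True
  then have "hits n {a..b} x = {1..0}" by simp
  then show ?thesis using n by (intro image_eqI[of _ _ "(1, 0)"]) auto
next
  case False
  let ?H = "hits n {a..b} x"
  define i where "i = Min ?H"
  define j where "j = Max ?H"
  have i: "i \<in> ?H" and j: "j \<in> ?H" using False by (auto simp: i_def j_def intro!: Min_in Max_in)
  have mono: "x k \<le> x l" if "k \<in> {1..n}" "l \<in> {1..n}" "k \<le> l" for k l
    using strict_mono_onD[OF x that(1,2)] that(3) by (cases "k = l") auto
  have "?H = {i..j}"
  proof (intro set_eqI iffI)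
    fix k assume "k \<in> ?H"
    then show "k \<in> {i..j}" by (simp add: i_def j_def)
  next
    fix k assume k: "k \<in> {i..j}"
    have "i \<in> {1..n}" "j \<in> {1..n}" using i j hits_subset by blast+
    then have k': "k \<in> {1..n}" using k by simp
    have "x i \<le> x k" "x k \<le> x j" using k by (auto intro!: mono k' \<open>i \<in> {1..n}\<close> \<open>j \<in> {1..n}\<close> simp del: atLeastAtMost_iff) (simp_all)
    then show "k \<in> ?H" using k' i j by (simp add: hits_def)
  qed
  moreover have "i \<in> {1..n}" "j \<in> {0..n}" using i j by (auto simp: hits_def)
  ultimately show ?thesis by (intro image_eqI[of _ _ "(i, j)"]) auto
qed

text \<open>
  The first multiple of \<open>h / 2\<close> in \<open>[a, b]\<close> is below \<open>a + h / 2\<close>, so the cell starting there ends before \<open>a + h \<le> b\<close>.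
\<close>
lemma long_segment_contains_cell:
  fixes h :: real
  assumes h: "0 < h" and G: "G \<in> long_members segments h"
  obtains k where "k < nat \<lfloor>2 / h\<rfloor>" "{real k * (h / 2)..real (Suc k) * (h / 2)} \<subseteq> G"
proof -
  obtain a b where ab: "G = {a..b}" "0 \<le> a" "a \<le> b" "b \<le> 1" "h \<le> b - a"
    using G by (auto simp: long_members_segments)
  define k where "k = nat \<lceil>2 * a / h\<rceil>"
  have "0 \<le> 2 * a / h" using ab h by simp
  then have k: "real k = of_int \<lceil>2 * a / h\<rceil>" unfolding k_def by simp
  have "2 * a / h \<le> real k" "real k < 2 * a / h + 1" unfolding k by linarith+
  then have lo: "a \<le> real k * (h / 2)" and hi: "real k * (h / 2) < a + h / 2"
    using h by (simp_all add: field_simps)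
  then have hi': "real (Suc k) * (h / 2) < b" using ab by (simp add: algebra_simps)
  have "real (Suc k) \<le> 2 / h" using hi' ab h by (simp add: field_simps)
  then have "int (Suc k) \<le> \<lfloor>2 / h\<rfloor>" by (simp add: le_floor_iff)
  then have "k < nat \<lfloor>2 / h\<rfloor>" by linarith
  moreover have "{real k * (h / 2)..real (Suc k) * (h / 2)} \<subseteq> G" using ab lo hi' by auto
  ultimately show ?thesis by (rule that)
qed

lemma scan_stat_observe:
  "scan_stat n (observe n G x \<xi>) G' =
    (\<Sum>i\<in>hits n G' x. indicator G (x i) + \<xi> i) - real (card (x ` hits n G' x)) / 2"
proof -
  have "(\<Sum>i\<in>{1..n}. (\<lambda>i\<in>{1..n}. indicator G (x i) + \<xi> i) i * indicator G' (x i))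
      = (\<Sum>i\<in>hits n G' x. indicator G (x i) + \<xi> i)"
    unfolding hits_def by (intro sum.mono_neutral_cong_right) (auto simp: indicator_def)
  moreover have "x ` {1..n} \<inter> G' = x ` hits n G' x" by (auto simp: hits_def)
  ultimately show ?thesis by (simp add: scan_stat_def observe_def)
qed

lemma nonneg_sum_half:
  fixes f :: "nat \<Rightarrow> real"
  assumes "0 \<le> (\<Sum>i\<in>I. f i) - real (card I) / 2" "0 \<le> u"
  shows "0 \<le> (\<Sum>i\<in>I. u * (f i - 1 / 2))"
  using assms by (simp add: sum_distrib_left[symmetric] sum_subtractf)

text \<open>
  The optimal Chernoff exponent \<open>max u. u / 2 - \<sigma>\<^sup>2 * u\<^sup>2 / 2\<close> for a \<open>\<sigma>\<close>-subgaussian mean to exceed \<open>1 / 2\<close>.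
\<close>
definition chernoff_rate :: "real \<Rightarrow> real" where
  "chernoff_rate \<sigma> = 1 / (8 * \<sigma>\<^sup>2)"

locale subgaussian_regression = regression +
  fixes \<sigma> :: real
  assumes sigma_pos: "0 < \<sigma>" and subgaussian: "subgaussian_noise \<sigma> \<nu>"
begin

abbreviation \<kappa> :: real where "\<kappa> \<equiv> chernoff_rate \<sigma>"

lemma kappa_pos: "0 < \<kappa>"
  using sigma_pos by (simp add: chernoff_rate_def)

text \<open>
  The sign \<open>s\<close> makes the bound available for both errors: \<open>s = 1\<close> for false rejection and \<open>s = - 1\<close> for
  false acceptance.
\<close>
lemma half_mean_chernoff:
  assumes I: "I \<subseteq> {1..n}" and s: "\<bar>s\<bar> = 1"
    and A: "\<And>\<xi>. \<xi> \<in> A \<Longrightarrow> \<xi> \<in> space (vec_space n) \<and> 0 \<le> (\<Sum>i\<in>I. s * \<xi> i) - real (card I) / 2"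
  shows "measure (noise_vector \<nu> n) A \<le> exp (- \<kappa> * real (card I))"
proof -
  \<comment> \<open>the maximiser of \<open>u / 2 - \<sigma>\<^sup>2 * u\<^sup>2 / 2\<close>\<close>
  define u where "u = 1 / (2 * \<sigma>\<^sup>2)"
  have u: "0 < u" using sigma_pos by (simp add: u_def)
  let ?g = "\<lambda>z. u * (s * z - 1 / 2)"
  have eq: "exp (?g z) = exp (- u / 2) * exp ((u * s) * z)" for z
    by (simp add: exp_add[symmetric] algebra_simps)
  have sub: "integrable \<nu> (\<lambda>z. exp ((u * s) * z))" "(\<integral>z. exp ((u * s) * z) \<partial>\<nu>) \<le> exp (\<sigma>\<^sup>2 * (u * s)\<^sup>2 / 2)"
    using subgaussian unfolding subgaussian_noise_def by blast+
  have s2: "s\<^sup>2 = 1" using s by (metis power2_abs one_power2)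
  have "(\<integral>z. exp (?g z) \<partial>\<nu>) \<le> exp (- u / 2) * exp (\<sigma>\<^sup>2 * (u * s)\<^sup>2 / 2)"
    unfolding eq using sub by simp
  also have "\<dots> = exp (- \<kappa>)"
    using sigma_pos by (simp add: exp_add[symmetric] u_def chernoff_rate_def power_mult_distrib s2 field_simps)
  finally have mgf: "(\<integral>z. exp (?g z) \<partial>\<nu>) \<le> exp (- \<kappa>)" .
  have "measure (noise_vector \<nu> n) A \<le> (\<integral>z. exp (?g z) \<partial>\<nu>) ^ card I"
  proof (rule noise_chernoff[OF I])
    show "integrable \<nu> (\<lambda>z. exp (?g z))" unfolding eq using sub by simp
    show "A \<subseteq> {\<xi> \<in> space (vec_space n). 0 \<le> (\<Sum>i\<in>I. ?g (\<xi> i))}"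
      using A nonneg_sum_half[of "\<lambda>i. s * _ i" I u] u by fastforce
  qed simp
  also have "\<dots> \<le> exp (- \<kappa>) ^ card I"
    by (intro power_mono mgf) (simp add: integral_nonneg_AE)
  also have "\<dots> = exp (- \<kappa> * real (card I))" using exp_of_nat2_mult[of "- \<kappa>" "card I"] by simp
  finally show ?thesis .
qed

lemma expected_exp_neg_hits:
  assumes "0 \<le> a" "a \<le> b" "b \<le> 1"
  shows "(\<integral>x. exp (- \<kappa> * real (card (hits n {a..b} x))) \<partial>D n)
    \<le> exp (\<kappa> + (exp (- \<kappa>) - 1) * (real n * (b - a)))"
  using design.exp_hits_le[OF assms, of "- \<kappa>"] kappa_pos by simp

text \<open>
  It suffices to look at the scan statistic at the true segment. On it \<open>Y = 1 + \<xi>\<close>, so a negative value means that the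
  noise averages to less than \<open>- 1 / 2\<close>.
\<close>
lemma test1_power:
  assumes h: "h < 1" and G: "G \<in> long_members segments h"
  shows "measure (obs_law D \<nu> n G) {\<omega> \<in> space (sample_space n). test1 n h \<omega> = 0}
    \<le> exp (\<kappa> + (exp (- \<kappa>) - 1) * (real n * h))"
proof -
  obtain a b where ab: "G = {a..b}" "0 \<le> a" "a \<le> b" "b \<le> 1" "h \<le> b - a"
    using G by (auto simp: long_members_segments)
  then have GB: "G \<in> sets borel" by simp
  have "measure (obs_law D \<nu> n G) {\<omega> \<in> space (sample_space n). test1 n h \<omega> = 0}
      \<le> (\<integral>x. exp (- \<kappa> * real (card (hits n G x))) \<partial>D n)"
  proof (rule obs_law_le_integral[OF GB is_test_sets(2)[OF test1_is_test[OF h]] exp_hits_integrable[OF GB]])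
    show "AE x in D n. measure (noise_vector \<nu> n) {\<xi> \<in> space (vec_space n).
        observe n G x \<xi> \<in> {\<omega> \<in> space (sample_space n). test1 n h \<omega> = 0}} \<le> exp (- \<kappa> * real (card (hits n G x)))"
    proof (rule AE_I2, rule half_mean_chernoff[OF hits_subset, of "- 1"])
      fix x \<xi> assume "\<xi> \<in> {\<xi> \<in> space (vec_space n). observe n G x \<xi> \<in> {\<omega> \<in> space (sample_space n). test1 n h \<omega> = 0}}"
      then have \<xi>: "\<xi> \<in> space (vec_space n)" "test1 n h (observe n G x \<xi>) = 0" by auto
      have "scan_stat n (observe n G x \<xi>) G < 0"
        using \<xi>(2) G unfolding test1_eq[OF h] by (auto split: if_splits)
      moreover have "(\<Sum>i\<in>hits n G x. indicator G (x i) + \<xi> i) = (\<Sum>i\<in>hits n G x. 1 + \<xi> i)"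
        by (intro sum.cong) (auto simp: hits_def)
      moreover have "real (card (x ` hits n G x)) \<le> real (card (hits n G x))"
        by (simp add: card_image_le)
      ultimately show "\<xi> \<in> space (vec_space n) \<and> 0 \<le> (\<Sum>i\<in>hits n G x. - 1 * \<xi> i) - real (card (hits n G x)) / 2"
        using \<xi>(1) by (simp add: scan_stat_observe sum.distrib sum_negf)
    qed simp
  qed simp
  also have "\<dots> \<le> exp (\<kappa> + (exp (- \<kappa>) - 1) * (real n * (b - a)))"
    unfolding ab(1) by (rule expected_exp_neg_hits[OF ab(2-4)])
  also have "\<dots> \<le> exp (\<kappa> + (exp (- \<kappa>) - 1) * (real n * h))"
    using ab(5) kappa_pos by (simp add: mult_left_mono_neg mult_left_mono)
  finally show ?thesis .
qed

text \<open>
  A union bound over the index sets cut out by long segments. An index set could be small, but never smaller than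
  the count in a cell contained in the segment, so \<open>exp (- \<kappa> * card I)\<close> is at most the sum of the corresponding terms
  over all cells. This sum no longer depends on the segment, and its expectation is a sum of \<open>K \<le> 2 / h\<close> exponential moments.
\<close>
lemma test1_level:
  assumes h: "0 < h" "h < 1" and n: "1 \<le> n"
  shows "measure (obs_law D \<nu> n {}) {\<omega> \<in> space (sample_space n). test1 n h \<omega> = 1}
    \<le> (real n * (real n + 1)) * (2 / h * exp (\<kappa> + (exp (- \<kappa>) - 1) * (real n * (h / 2))))"
proof -
  interpret N: prob_space "noise_vector \<nu> n" by (rule prob_space_noise_vector)
  define K where "K = nat \<lfloor>2 / h\<rfloor>"
  define cell where "cell k = {real k * (h / 2)..real (Suc k) * (h / 2)}" for k
  define f where "f x = (real n * (real n + 1)) * (\<Sum>k<K. exp (- \<kappa> * real (card (hits n (cell k) x))))" for x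
  have K: "real K \<le> 2 / h" using h unfolding K_def by simp
  have cellB: "cell k \<in> sets borel" for k by (simp add: cell_def)
  have "measure (obs_law D \<nu> n {}) {\<omega> \<in> space (sample_space n). test1 n h \<omega> = 1} \<le> (\<integral>x. f x \<partial>D n)"
  proof (rule obs_law_le_integral[OF _ is_test_sets(1)[OF test1_is_test[OF h(2)]]])
    show "integrable (D n) f" unfolding f_def
      by (intro integrable_mult_right Bochner_Integration.integrable_sum exp_hits_integrable cellB)
    show "0 \<le> f x" for x unfolding f_def by (intro mult_nonneg_nonneg sum_nonneg) auto
    show "AE x in D n. measure (noise_vector \<nu> n) {\<xi> \<in> space (vec_space n).
        observe n {} x \<xi> \<in> {\<omega> \<in> space (sample_space n). test1 n h \<omega> = 1}} \<le> f x"
      using design.design_strict_mono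
    proof eventually_elim
      case (elim x)
      define T where "T = (\<lambda>G. hits n G x) ` long_members segments h"
      define E where "E I = {\<xi> \<in> space (noise_vector \<nu> n). 0 \<le> (\<Sum>i\<in>I. 1 * \<xi> i) - real (card I) / 2}" for I
      define c where "c = (\<Sum>k<K. exp (- \<kappa> * real (card (hits n (cell k) x))))"
      have T_sub: "T \<subseteq> (\<lambda>(i, j). {i..j}) ` ({1..n} \<times> {0..n})"
        unfolding T_def using strict_mono_hits_interval[OF elim n] by (force simp: long_members_segments)
      have finT: "finite T" by (rule finite_subset[OF T_sub]) auto
      have "card T \<le> card ((\<lambda>(i, j). {i..j}) ` ({1..n} \<times> {0..n}))" by (rule card_mono[OF _ T_sub]) auto
      also have "\<dots> \<le> card ({1..n} \<times> {0..n})" by (rule card_image_le) auto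
      finally have "real (card T) \<le> real (n * (n + 1))" unfolding of_nat_le_iff by simp
      then have cardT: "real (card T) \<le> real n * (real n + 1)" by (simp add: algebra_simps)
      have T_range: "I \<subseteq> {1..n}" if "I \<in> T" for I using that hits_subset by (auto simp: T_def)
      have E_meas: "E I \<in> sets (noise_vector \<nu> n)" if "I \<in> T" for I
      proof -
        have [measurable]: "(\<lambda>\<xi>. \<xi> i) \<in> borel_measurable (noise_vector \<nu> n)" if "i \<in> I" for i
          using that T_range[OF \<open>I \<in> T\<close>] unfolding measurable_cong_sets[OF sets_noise_vector refl] by auto
        show ?thesis unfolding E_def by measurable
      qed
      have E_prob: "measure (noise_vector \<nu> n) (E I) \<le> c" if I: "I \<in> T" for I
      proof -
        obtain G where G: "I = hits n G x" "G \<in> long_members segments h" using I by (auto simp: T_def)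
        obtain k where k: "k < K" "cell k \<subseteq> G"
          using long_segment_contains_cell[OF h(1) G(2)] unfolding K_def cell_def by blast
        have "measure (noise_vector \<nu> n) (E I) \<le> exp (- \<kappa> * real (card I))"
          by (rule half_mean_chernoff[OF T_range[OF I], of 1]) (auto simp: E_def space_noise_vector)
        also have "\<dots> \<le> exp (- \<kappa> * real (card (hits n (cell k) x)))"
        proof -
          have "card (hits n (cell k) x) \<le> card I"
            unfolding G(1) using k(2) by (intro card_mono) (auto simp: hits_def)
          then show ?thesis using kappa_pos by simp
        qed
        also have "\<dots> \<le> c" unfolding c_def using k(1) by (intro member_le_sum) auto
        finally show ?thesis .
      qed
      have "{\<xi> \<in> space (vec_space n). observe n {} x \<xi> \<in> {\<omega> \<in> space (sample_space n). test1 n h \<omega> = 1}} \<subseteq> (\<Union>I\<in>T. E I)"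
      proof
        fix \<xi> assume "\<xi> \<in> {\<xi> \<in> space (vec_space n). observe n {} x \<xi> \<in> {\<omega> \<in> space (sample_space n). test1 n h \<omega> = 1}}"
        then have \<xi>: "\<xi> \<in> space (vec_space n)" "test1 n h (observe n {} x \<xi>) = 1" by auto
        then obtain G where G: "G \<in> long_members segments h" "0 \<le> scan_stat n (observe n {} x \<xi>) G"
          unfolding test1_eq[OF h(2)] by (auto split: if_splits)
        have "inj_on x (hits n G x)"
          using strict_mono_on_imp_inj_on[OF elim] hits_subset by (rule inj_on_subset)
        then have "card (x ` hits n G x) = card (hits n G x)" by (rule card_image)
        then have "\<xi> \<in> E (hits n G x)"
          using G(2) \<xi>(1) unfolding scan_stat_observe by (simp add: E_def space_noise_vector)
        then show "\<xi> \<in> (\<Union>I\<in>T. E I)" using G(1) by (auto simp: T_def)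
      qed
      then have "measure (noise_vector \<nu> n) {\<xi> \<in> space (vec_space n). observe n {} x \<xi> \<in> {\<omega> \<in> space (sample_space n). test1 n h \<omega> = 1}}
          \<le> measure (noise_vector \<nu> n) (\<Union>I\<in>T. E I)"
        using E_meas finT by (intro N.finite_measure_mono) auto
      also have "\<dots> \<le> (\<Sum>I\<in>T. measure (noise_vector \<nu> n) (E I))"
        using E_meas by (intro N.finite_measure_subadditive_finite finT) auto
      also have "\<dots> \<le> real (card T) * c" by (rule sum_bounded_above[OF E_prob])
      also have "\<dots> \<le> f x" unfolding f_def c_def
        by (intro mult_right_mono cardT sum_nonneg) auto
      finally show ?case .
    qed
  qed simp
  also have "(\<integral>x. f x \<partial>D n) = (real n * (real n + 1)) * (\<Sum>k<K. \<integral>x. exp (- \<kappa> * real (card (hits n (cell k) x))) \<partial>D n)"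
    unfolding f_def using exp_hits_integrable[OF cellB, of "- \<kappa>"] by (simp add: Bochner_Integration.integral_sum)
  also have "\<dots> \<le> (real n * (real n + 1)) * (2 / h * exp (\<kappa> + (exp (- \<kappa>) - 1) * (real n * (h / 2))))"
  proof (intro mult_left_mono)
    have cell_le: "(\<integral>x. exp (- \<kappa> * real (card (hits n (cell k) x))) \<partial>D n) \<le> exp (\<kappa> + (exp (- \<kappa>) - 1) * (real n * (h / 2)))"
      if "k \<in> {..<K}" for k
    proof -
      have "int (Suc k) \<le> \<lfloor>2 / h\<rfloor>" using that unfolding K_def by simp
      then have "real (Suc k) \<le> 2 / h" by (simp add: le_floor_iff)
      then have "real (Suc k) * (h / 2) \<le> 1" using h by (simp add: field_simps)
      then have "(\<integral>x. exp (- \<kappa> * real (card (hits n (cell k) x))) \<partial>D n)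
          \<le> exp (\<kappa> + (exp (- \<kappa>) - 1) * (real n * (real (Suc k) * (h / 2) - real k * (h / 2))))"
        unfolding cell_def using h by (intro expected_exp_neg_hits mult_right_mono) auto
      also have "real (Suc k) * (h / 2) - real k * (h / 2) = h / 2" by (simp add: algebra_simps)
      finally show ?thesis .
    qed
    have "(\<Sum>k<K. \<integral>x. exp (- \<kappa> * real (card (hits n (cell k) x))) \<partial>D n)
        \<le> real K * exp (\<kappa> + (exp (- \<kappa>) - 1) * (real n * (h / 2)))"
      using sum_bounded_above[of "{..<K}", OF cell_le] by simp
    also have "\<dots> \<le> 2 / h * exp (\<kappa> + (exp (- \<kappa>) - 1) * (real n * (h / 2)))"
      by (intro mult_right_mono K) simp
    finally show "(\<Sum>k<K. \<integral>x. exp (- \<kappa> * real (card (hits n (cell k) x))) \<partial>D n)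
        \<le> 2 / h * exp (\<kappa> + (exp (- \<kappa>) - 1) * (real n * (h / 2)))" .
  qed simp
  finally show ?thesis .
qed

end

text \<open>
  Once \<open>n * h \<ge> (8 / \<alpha>) * ln n\<close> with \<open>\<alpha> = 1 - exp (- \<kappa>)\<close>, the exponential factor is at most a constant times \<open>n powr - 4\<close>,
  against the polynomial factor \<open>n * (n + 1) * 2 / h \<le> 2 * n\<^sup>2 * (n + 1)\<close>.
\<close>
theorem test1_consistent:
  assumes reg: "\<And>n. 1 \<le> n \<Longrightarrow> subgaussian_regression D n \<nu> \<sigma>"
    and h: "\<forall>n\<ge>1. 0 < h n \<and> h n < 1"
    and lim: "filterlim (\<lambda>n. real n * h n / ln (real n)) at_top sequentially"
  shows "consistent_test D \<nu> h segments (\<lambda>n. test1 n (h n))"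
proof -
  interpret one: subgaussian_regression D 1 \<nu> \<sigma> by (rule reg) simp
  define \<kappa> where "\<kappa> = chernoff_rate \<sigma>"
  have \<kappa>: "0 < \<kappa>" using one.kappa_pos by (simp add: \<kappa>_def)
  define \<alpha> where "\<alpha> = 1 - exp (- \<kappa>)"
  have \<alpha>: "0 < \<alpha>" using \<kappa> by (simp add: \<alpha>_def)
  define b where "b n = (real n * (real n + 1)) * (2 * real n * (exp \<kappa> * real n powr - 4)) + exp \<kappa> * real n powr - 4" for n
  show ?thesis
  proof (rule consistent_testI)
    show "is_test n (test1 n (h n))" if "1 \<le> n" for n using h that by (intro test1_is_test) auto
    show "\<forall>\<^sub>F n in sequentially. 0 \<le> test_risk D \<nu> n (h n) (test1 n (h n)) segments"
      using eventually_ge_at_top[of 1]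
    proof eventually_elim
      case (elim n)
      then interpret subgaussian_regression D n \<nu> \<sigma> by (intro reg)
      show ?case using h elim unit_interval_long_member(1)[of "h n"]
        by (intro test_risk_nonneg[OF regression_axioms segments_borel(1)]) auto
    qed
    have "\<forall>\<^sub>F n in sequentially. max (8 / \<alpha>) 1 \<le> real n * h n / ln (real n)"
      using lim unfolding filterlim_at_top by blast
    then show "\<forall>\<^sub>F n in sequentially. test_risk D \<nu> n (h n) (test1 n (h n)) segments \<le> b n"
      \<comment> \<open>\<open>n \<ge> 3\<close> makes \<open>ln n \<ge> 1\<close>\<close>
      using eventually_ge_at_top[of 3]
    proof eventually_elim
      case (elim n)
      interpret subgaussian_regression D n \<nu> \<sigma> by (rule reg) (use elim in simp)
      have hn: "0 < h n" "h n < 1" using h elim by auto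
      have "exp 1 \<le> real n" using exp_le elim by linarith
      then have ln: "1 \<le> ln (real n)" using elim by (subst ln_ge_iff) auto
      have big: "8 / \<alpha> * ln (real n) \<le> real n * h n" "ln (real n) \<le> real n * h n"
        using elim ln by (simp_all add: field_simps)
      have inv: "2 / h n \<le> 2 * real n" using big ln hn by (simp add: field_simps)
      have expo: "exp (\<kappa> + (exp (- \<kappa>) - 1) * (real n * (h n / 2))) \<le> exp \<kappa> * real n powr - 4"
        "exp (\<kappa> + (exp (- \<kappa>) - 1) * (real n * h n)) \<le> exp \<kappa> * real n powr - 4"
      proof -
        have "8 * ln (real n) \<le> \<alpha> * (real n * h n)" using big(1) \<alpha> by (simp add: field_simps)
        then have "- \<alpha> * (real n * (h n / 2)) \<le> - 4 * ln (real n)" "- \<alpha> * (real n * h n) \<le> - 4 * ln (real n)"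
          using ln by (simp_all add: algebra_simps)
        moreover have "exp \<kappa> * real n powr - 4 = exp (\<kappa> + - 4 * ln (real n))"
          using elim by (simp add: powr_def exp_add[symmetric])
        moreover have "(exp (- \<kappa>) - 1) * z = - \<alpha> * z" for z by (simp add: \<alpha>_def)
        ultimately show "exp (\<kappa> + (exp (- \<kappa>) - 1) * (real n * (h n / 2))) \<le> exp \<kappa> * real n powr - 4"
          "exp (\<kappa> + (exp (- \<kappa>) - 1) * (real n * h n)) \<le> exp \<kappa> * real n powr - 4"
          by (simp_all only: exp_le_cancel_iff add_le_cancel_left)
      qed
      show ?case unfolding b_def
      proof (rule test_risk_le)
        show "long_members segments (h n) \<noteq> {}" using unit_interval_long_member(1)[of "h n"] hn by auto
        have "(real n * (real n + 1)) * (2 / h n * exp (\<kappa> + (exp (- \<kappa>) - 1) * (real n * (h n / 2))))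
            \<le> (real n * (real n + 1)) * (2 * real n * (exp \<kappa> * real n powr - 4))"
          by (intro mult_left_mono mult_mono inv expo) auto
        then show "measure (obs_law D \<nu> n {}) {\<omega> \<in> space (sample_space n). test1 n (h n) \<omega> = 1}
            \<le> (real n * (real n + 1)) * (2 * real n * (exp \<kappa> * real n powr - 4))"
          using test1_level[OF hn] elim unfolding \<kappa>_def by simp
        show "measure (obs_law D \<nu> n G) {\<omega> \<in> space (sample_space n). test1 n (h n) \<omega> = 0} \<le> exp \<kappa> * real n powr - 4"
          if "G \<in> long_members segments (h n)" for G
          using test1_power[OF hn(2) that] expo(2) unfolding \<kappa>_def by linarith
      qed
    qed
    show "b \<longlonglongrightarrow> 0" unfolding b_def by real_asymp
  qed
qed

section \<open>Lower bound for initial segments\<close>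

lemma is_test_complement:
  assumes "prob_space M" "sets M = sets (sample_space n)" "is_test n \<tau>"
  shows "measure M {\<omega> \<in> space (sample_space n). \<tau> \<omega> = 0} = 1 - measure M {\<omega> \<in> space (sample_space n). \<tau> \<omega> = 1}"
proof -
  interpret prob_space M by fact
  have sp: "space M = space (sample_space n)" using sets_eq_imp_space_eq[OF assms(2)] .
  have "\<tau> \<omega> \<in> {0, 1}" if "\<omega> \<in> space (sample_space n)" for \<omega>
    using measurable_space[OF assms(3)[unfolded is_test_def] that] by simp
  then have "{\<omega> \<in> space (sample_space n). \<tau> \<omega> = 0} = space M - {\<omega> \<in> space (sample_space n). \<tau> \<omega> = 1}"
    unfolding sp by auto
  then show ?thesis using is_test_sets(1)[OF assms(3)] assms(2) by (simp add: prob_compl)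
qed

context regression
begin

lemma sets_obs_law: "sets (obs_law D \<nu> n G) = sets (sample_space n)"
  by (simp add: obs_law_def)

lemma hit_event: "{x \<in> space (D n). hits n {0..t} x \<noteq> {}} \<in> sets (D n)"
proof -
  have "{x \<in> space (vec_space n). \<exists>i\<in>{1..n}. x i \<in> {0..t}} \<in> sets (vec_space n)" by measurable
  moreover have "hits n {0..t} x \<noteq> {} \<longleftrightarrow> (\<exists>i\<in>{1..n}. x i \<in> {0..t})" for x
    unfolding hits_def by blast
  ultimately show ?thesis by (simp only: space_design sets_design_vec)
qed

text \<open>
  With the same design and noise, the samples for \<open>{}\<close> and for \<open>[0, t]\<close> coincide unless a design point falls into \<open>[0, t]\<close>.
\<close>
lemma obs_law_initial_segment_close:
  assumes t: "0 \<le> t" "t \<le> 1" and A: "A \<in> sets (sample_space n)"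
  shows "measure (obs_law D \<nu> n {}) A \<le> measure (obs_law D \<nu> n {0..t}) A + real n * t"
proof -
  interpret N: prob_space "noise_vector \<nu> n" by (rule prob_space_noise_vector)
  interpret J: pair_prob_space "D n" "noise_vector \<nu> n" ..
  let ?J = "D n \<Otimes>\<^sub>M noise_vector \<nu> n"
  let ?T = "\<lambda>G. (\<lambda>(x, \<xi>). observe n G x \<xi>) -` A \<inter> space ?J"
  let ?H = "{x \<in> space (D n). hits n {0..t} x \<noteq> {}}"
  have T: "?T G \<in> sets ?J" if "G \<in> sets borel" for G
    by (rule measurable_sets[OF observe_measurable[OF that] A])
  have H: "?H \<times> space (noise_vector \<nu> n) \<in> sets ?J" using hit_event by simp
  have m: "measure (obs_law D \<nu> n G) A = measure ?J (?T G)" if "G \<in> sets borel" for G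
    unfolding obs_law_eq by (rule measure_distr[OF observe_measurable[OF that] A])
  have sub: "?T {} \<subseteq> ?T {0..t} \<union> ?H \<times> space (noise_vector \<nu> n)"
  proof
    fix p assume p: "p \<in> ?T {}"
    obtain x \<xi> where [simp]: "p = (x, \<xi>)" by (cases p)
    show "p \<in> ?T {0..t} \<union> ?H \<times> space (noise_vector \<nu> n)"
    proof (cases "hits n {0..t} x = {}")
      case True
      then have "x i \<notin> {0..t}" if "i \<in> {1..n}" for i using that unfolding hits_def by blast
      then have "observe n {0..t} x \<xi> = observe n {} x \<xi>"
        unfolding observe_def by (intro arg_cong[where f="Pair x"] restrict_ext) (simp add: indicator_def)
      then show ?thesis using p by simp
    next
      case False
      then show ?thesis using p by (simp add: space_pair_measure)
    qed
  qed
  have "measure ?J (?T {}) \<le> measure ?J (?T {0..t} \<union> ?H \<times> space (noise_vector \<nu> n))"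
    using sub T H by (intro J.finite_measure_mono) auto
  also have "\<dots> \<le> measure ?J (?T {0..t}) + measure ?J (?H \<times> space (noise_vector \<nu> n))"
    using T H by (intro measure_Un_le) auto
  also have "measure ?J (?H \<times> space (noise_vector \<nu> n)) = measure (D n) ?H"
    using hit_event N.emeasure_pair_measure_Times[OF hit_event, of "space (noise_vector \<nu> n)"]
    by (simp add: measure_def N.emeasure_space_1)
  also have "\<dots> \<le> real n * t" by (rule design.hit_prob_le[OF t])
  finally show ?thesis by (simp add: m)
qed

lemma test_risk_initial_segments_ge:
  assumes h: "0 < h" "h < 1" and \<tau>: "is_test n \<tau>"
  shows "1 - real n * h \<le> test_risk D \<nu> n h \<tau> segments0"
proof -
  have "1 = measure (obs_law D \<nu> n {}) {\<omega> \<in> space (sample_space n). \<tau> \<omega> = 1}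
      + measure (obs_law D \<nu> n {}) {\<omega> \<in> space (sample_space n). \<tau> \<omega> = 0}"
    using is_test_complement[OF prob_space_obs_law sets_obs_law \<tau>, of "{}"] by simp
  also have "\<dots> \<le> measure (obs_law D \<nu> n {}) {\<omega> \<in> space (sample_space n). \<tau> \<omega> = 1}
      + measure (obs_law D \<nu> n {0..h}) {\<omega> \<in> space (sample_space n). \<tau> \<omega> = 0} + real n * h"
    using obs_law_initial_segment_close[OF _ _ is_test_sets(2)[OF \<tau>], of h] h by simp
  also have "\<dots> \<le> test_risk D \<nu> n h \<tau> segments0 + real n * h"
    using h by (intro add_right_mono test_risk_ge segments_borel) (auto simp: long_members_segments0)
  finally show ?thesis by simp
qed

end

theorem no_consistent_test_initial_segments:
  assumes reg: "\<And>n. 1 \<le> n \<Longrightarrow> regression D n \<nu>"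
    and h: "\<forall>n\<ge>1. 0 < h n \<and> h n < 1"
    and lim: "(\<lambda>n. real n * h n) \<longlonglongrightarrow> 0"
  shows "\<not> consistent_test D \<nu> h segments0 \<tau>"
proof
  assume "consistent_test D \<nu> h segments0 \<tau>"
  then have \<tau>: "\<And>n. 1 \<le> n \<Longrightarrow> is_test n (\<tau> n)"
    and risk: "(\<lambda>n. test_risk D \<nu> n (h n) (\<tau> n) segments0) \<longlonglongrightarrow> 0"
    unfolding consistent_test_def by auto
  have "(\<lambda>n. 1 - real n * h n) \<longlonglongrightarrow> 1 - 0" by (intro tendsto_intros lim)
  moreover have "\<forall>\<^sub>F n in sequentially. 1 - real n * h n \<le> test_risk D \<nu> n (h n) (\<tau> n) segments0"
    using eventually_ge_at_top[of 1]
    by eventually_elim (use h in \<open>auto intro!: regression.test_risk_initial_segments_ge[OF reg] \<tau>\<close>)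
  ultimately have "(1 - 0 :: real) \<le> 0"
    using risk by (intro tendsto_le[OF sequentially_bot]) auto
  then show False by simp
qed

section \<open>Testing against a mixture\<close>

text \<open>
  The second moment method. With the mixture \<open>X = (\<Sum>j. L j) / m\<close>, the average of the integrals of \<open>L j\<close> over \<open>B\<close>
  is the integral of \<open>X\<close> over \<open>B\<close>, which falls short of \<open>prob B\<close> by at most \<open>E \<bar>X - 1\<bar> \<le> sqrt (Var X)\<close>. Since the
  off-diagonal products contribute at most the square of the mean, \<open>Var X \<le> V / m\<close>.
\<close>
lemma (in prob_space) mixture_second_moment:
  fixes L :: "'b \<Rightarrow> 'a \<Rightarrow> real"
  assumes J: "finite J" "J \<noteq> {}" and V: "0 < V"
    and prod: "\<And>j k. j \<in> J \<Longrightarrow> k \<in> J \<Longrightarrow> integrable M (\<lambda>\<omega>. L j \<omega> * L k \<omega>)"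
    and int: "\<And>j. j \<in> J \<Longrightarrow> integrable M (L j)"
    and one: "\<And>j. j \<in> J \<Longrightarrow> (\<integral>\<omega>. L j \<omega> \<partial>M) = 1"
    and off: "\<And>j k. j \<in> J \<Longrightarrow> k \<in> J \<Longrightarrow> j \<noteq> k \<Longrightarrow> (\<integral>\<omega>. L j \<omega> * L k \<omega> \<partial>M) \<le> 1"
    and diag: "\<And>j. j \<in> J \<Longrightarrow> (\<integral>\<omega>. L j \<omega> * L j \<omega> \<partial>M) \<le> V"
    and B: "B \<in> events" and \<beta>: "\<And>j. j \<in> J \<Longrightarrow> (\<integral>\<omega>. L j \<omega> * indicator B \<omega> \<partial>M) \<le> \<beta>"
  shows "prob B - sqrt (V / real (card J)) \<le> \<beta>"
proof -
  define m where "m = real (card J)"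
  have m: "0 < m" using J by (simp add: m_def card_gt_0_iff)
  define s where "s = sqrt (V / m)"
  have s: "0 < s" "s\<^sup>2 = V / m" using V m by (simp_all add: s_def)
  define X where "X \<omega> = (\<Sum>j\<in>J. L j \<omega>) / m" for \<omega>
  have intX: "integrable M X" unfolding X_def using int by (intro integrable_divide Bochner_Integration.integrable_sum)
  have EX: "(\<integral>\<omega>. X \<omega> \<partial>M) = 1"
    unfolding X_def using int one m by (simp add: Bochner_Integration.integral_sum m_def)
  have X2: "(X \<omega>)\<^sup>2 = (\<Sum>j\<in>J. \<Sum>k\<in>J. L j \<omega> * L k \<omega>) / m\<^sup>2" for \<omega>
    by (simp add: X_def power_divide power2_eq_square[of "sum _ _"] sum_product)
  have intX2: "integrable M (\<lambda>\<omega>. (X \<omega>)\<^sup>2)"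
    unfolding X2 using prod by (intro integrable_divide Bochner_Integration.integrable_sum)
  have "(\<integral>\<omega>. (X \<omega>)\<^sup>2 \<partial>M) = (\<Sum>j\<in>J. \<Sum>k\<in>J. \<integral>\<omega>. L j \<omega> * L k \<omega> \<partial>M) / m\<^sup>2"
    unfolding X2 using prod by (simp add: Bochner_Integration.integral_sum)
  also have "\<dots> \<le> (\<Sum>j\<in>J. \<Sum>k\<in>J. 1 + (if j = k then V else 0)) / m\<^sup>2"
  proof (intro divide_right_mono sum_mono)
    fix j k assume "j \<in> J" "k \<in> J"
    then show "(\<integral>\<omega>. L j \<omega> * L k \<omega> \<partial>M) \<le> 1 + (if j = k then V else 0)"
      using off[of j k] diag[of j] by (cases "j = k") auto
  qed simp
  also have "\<dots> = 1 + s\<^sup>2"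
  proof -
    have "(\<Sum>j\<in>J. \<Sum>k\<in>J. 1 + (if j = k then V else 0)) = m * (m + V)"
      using J by (simp add: sum.distrib m_def algebra_simps)
    also have "\<dots> / m\<^sup>2 = 1 + V / m" using m by (simp add: field_simps power2_eq_square)
    finally show ?thesis by (simp add: s(2))
  qed
  finally have EX2: "(\<integral>\<omega>. (X \<omega>)\<^sup>2 \<partial>M) \<le> 1 + s\<^sup>2" .
  have intB: "integrable M (\<lambda>\<omega>. indicator B \<omega> :: real)"
    using B by (intro integrable_real_indicator) (auto simp: emeasure_eq_measure)
  \<comment> \<open>from \<open>(s - (1 - X))\<^sup>2 \<ge> 0\<close>; integrating this avoids the absolute value of \<open>X - 1\<close>\<close>
  have pw: "indicator B \<omega> - X \<omega> * indicator B \<omega> \<le> s / 2 + ((X \<omega>)\<^sup>2 - 2 * X \<omega> + 1) / (2 * s)" for \<omega>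
  proof -
    have "0 \<le> (s - (1 - X \<omega>))\<^sup>2" by simp
    then have "2 * s * (1 - X \<omega>) \<le> s\<^sup>2 + (1 - X \<omega>)\<^sup>2" by (simp add: power2_eq_square algebra_simps)
    then have "1 - X \<omega> \<le> (s\<^sup>2 + (1 - X \<omega>)\<^sup>2) / (2 * s)" using s by (simp add: field_simps)
    also have "\<dots> = s / 2 + ((X \<omega>)\<^sup>2 - 2 * X \<omega> + 1) / (2 * s)"
      using s(1) by (simp add: field_simps power2_eq_square)
    finally have 1: "1 - X \<omega> \<le> s / 2 + ((X \<omega>)\<^sup>2 - 2 * X \<omega> + 1) / (2 * s)" .
    have "0 \<le> s / 2 + (X \<omega> - 1)\<^sup>2 / (2 * s)" using s(1) by (intro add_nonneg_nonneg) auto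
    then have 2: "0 \<le> s / 2 + ((X \<omega>)\<^sup>2 - 2 * X \<omega> + 1) / (2 * s)" by (simp add: power2_eq_square algebra_simps)
    show ?thesis using 1 2 by (simp add: indicator_def)
  qed
  have intXB: "integrable M (\<lambda>\<omega>. X \<omega> * indicator B \<omega>)"
    by (rule integrable_real_mult_indicator[OF B intX])
  have "prob B - (\<integral>\<omega>. X \<omega> * indicator B \<omega> \<partial>M) = (\<integral>\<omega>. indicator B \<omega> - X \<omega> * indicator B \<omega> \<partial>M)"
    using intB intXB B by (subst Bochner_Integration.integral_diff) auto
  also have "\<dots> \<le> (\<integral>\<omega>. s / 2 + ((X \<omega>)\<^sup>2 - 2 * X \<omega> + 1) / (2 * s) \<partial>M)"
    by (intro integral_mono pw Bochner_Integration.integrable_diff Bochner_Integration.integrable_add intB intXB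
      integrable_divide integrable_mult_right intX intX2 integrable_const)
  also have "\<dots> = s / 2 + ((\<integral>\<omega>. (X \<omega>)\<^sup>2 \<partial>M) - 1) / (2 * s)"
    using intX intX2 EX by (simp add: prob_space)
  also have "\<dots> \<le> s / 2 + s\<^sup>2 / (2 * s)"
    using EX2 s(1) by (intro add_left_mono divide_right_mono) auto
  also have "\<dots> = s" using s(1) by (simp add: power2_eq_square)
  finally have "prob B - s \<le> (\<integral>\<omega>. X \<omega> * indicator B \<omega> \<partial>M)" by simp
  also have "\<dots> = (\<Sum>j\<in>J. \<integral>\<omega>. L j \<omega> * indicator B \<omega> \<partial>M) / m"
  proof -
    have "integrable M (\<lambda>\<omega>. L j \<omega> * indicator B \<omega>)" if "j \<in> J" for j
      by (rule integrable_real_mult_indicator[OF B int[OF that]])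
    then show ?thesis unfolding X_def by (simp add: sum_distrib_right Bochner_Integration.integral_sum)
  qed
  also have "\<dots> \<le> (m * \<beta>) / m"
    using m \<beta> sum_bounded_above[of J "\<lambda>j. \<integral>\<omega>. L j \<omega> * indicator B \<omega> \<partial>M" \<beta>]
    by (intro divide_right_mono) (auto simp: m_def)
  also have "\<dots> = \<beta>" using m by simp
  finally show ?thesis by (simp add: s_def m_def)
qed

section \<open>Gaussian shifts and likelihood ratios\<close>

text \<open>
  Completing the square: the density of the shifted normal law is the exponential factor times the density of the centred one.
\<close>
lemma nn_integral_gaussian_shift:
  assumes \<sigma>: "0 < \<sigma>" and \<nu>: "gaussian_noise \<sigma> \<nu>" and [measurable]: "f \<in> borel_measurable borel"
  shows "(\<integral>\<^sup>+z. f (t + z) \<partial>\<nu>) = (\<integral>\<^sup>+z. ennreal (exp (t * z / \<sigma>\<^sup>2 - t\<^sup>2 / (2 * \<sigma>\<^sup>2))) * f z \<partial>\<nu>)"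
proof -
  let ?d = "normal_density 0 \<sigma>"
  have tilt: "?d z * exp (t * z / \<sigma>\<^sup>2 - t\<^sup>2 / (2 * \<sigma>\<^sup>2)) = ?d (z - t)" for z
  proof -
    have "- z\<^sup>2 / (2 * \<sigma>\<^sup>2) + (t * z / \<sigma>\<^sup>2 - t\<^sup>2 / (2 * \<sigma>\<^sup>2)) = - (z - t)\<^sup>2 / (2 * \<sigma>\<^sup>2)"
      using \<sigma> by (simp add: field_simps) (simp add: power2_eq_square algebra_simps)
    then have "exp (- z\<^sup>2 / (2 * \<sigma>\<^sup>2)) * exp (t * z / \<sigma>\<^sup>2 - t\<^sup>2 / (2 * \<sigma>\<^sup>2)) = exp (- (z - t)\<^sup>2 / (2 * \<sigma>\<^sup>2))"
      by (simp only: exp_add[symmetric])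
    then show ?thesis unfolding normal_density_def by simp
  qed
  have "(\<integral>\<^sup>+z. f (t + z) \<partial>\<nu>) = (\<integral>\<^sup>+z. ennreal (?d z) * f (t + z) \<partial>lborel)"
    using \<nu> unfolding gaussian_noise_def by (simp add: nn_integral_density)
  also have "\<dots> = (\<integral>\<^sup>+z. ennreal (?d (z - t)) * f z \<partial>lborel)"
    by (subst (2) nn_integral_real_affine[where c=1 and t=t]) simp_all
  also have "\<dots> = (\<integral>\<^sup>+z. ennreal (?d z) * (ennreal (exp (t * z / \<sigma>\<^sup>2 - t\<^sup>2 / (2 * \<sigma>\<^sup>2))) * f z) \<partial>lborel)"
    by (simp add: tilt[symmetric] ennreal_mult mult.assoc)
  also have "\<dots> = (\<integral>\<^sup>+z. ennreal (exp (t * z / \<sigma>\<^sup>2 - t\<^sup>2 / (2 * \<sigma>\<^sup>2))) * f z \<partial>\<nu>)"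
    using \<nu> unfolding gaussian_noise_def by (simp add: nn_integral_density)
  finally show ?thesis .
qed

locale gaussian_regression = regression +
  fixes \<sigma> :: real
  assumes sigma_pos: "0 < \<sigma>" and gaussian: "gaussian_noise \<sigma> \<nu>"
begin

text \<open>
  The total mass of the shifted law is 1; the rest is the constant by which the two exponents differ.
\<close>
lemma nn_integral_gaussian_exp:
  "(\<integral>\<^sup>+z. ennreal (exp (t * (z - 1 / 2) / \<sigma>\<^sup>2)) \<partial>\<nu>) = ennreal (exp ((t\<^sup>2 - t) / (2 * \<sigma>\<^sup>2)))"
proof -
  have "ennreal (exp (t * (z - 1 / 2) / \<sigma>\<^sup>2)) =
      ennreal (exp ((t\<^sup>2 - t) / (2 * \<sigma>\<^sup>2))) * (ennreal (exp (t * z / \<sigma>\<^sup>2 - t\<^sup>2 / (2 * \<sigma>\<^sup>2))) * 1)" for z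
    using sigma_pos by (simp add: ennreal_mult[symmetric] exp_add[symmetric] field_simps)
  then have "(\<integral>\<^sup>+z. ennreal (exp (t * (z - 1 / 2) / \<sigma>\<^sup>2)) \<partial>\<nu>) =
      ennreal (exp ((t\<^sup>2 - t) / (2 * \<sigma>\<^sup>2))) * (\<integral>\<^sup>+z. ennreal (exp (t * z / \<sigma>\<^sup>2 - t\<^sup>2 / (2 * \<sigma>\<^sup>2))) * 1 \<partial>\<nu>)"
    by (simp only:) (rule nn_integral_cmult, simp add: measurable_cong_sets[OF sets_noise refl])
  also have "(\<integral>\<^sup>+z. ennreal (exp (t * z / \<sigma>\<^sup>2 - t\<^sup>2 / (2 * \<sigma>\<^sup>2))) * 1 \<partial>\<nu>) = (\<integral>\<^sup>+z. 1 \<partial>\<nu>)"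
    using nn_integral_gaussian_shift[OF sigma_pos gaussian, of "\<lambda>_. 1" t] by simp
  finally show ?thesis using noise.emeasure_space_1 by simp
qed

text \<open>
  The law of the shifted noise vector and the noise law weighted by the product of the one-dimensional densities
  are both the product of the shifted one-dimensional laws.
\<close>
lemma emeasure_noise_vector_shift:
  fixes g :: "nat \<Rightarrow> real"
  assumes B: "B \<in> sets (vec_space n)"
  shows "emeasure (noise_vector \<nu> n) {\<xi> \<in> space (vec_space n). (\<lambda>i\<in>{1..n}. g i + \<xi> i) \<in> B}
    = (\<integral>\<^sup>+\<xi>. (\<Prod>i\<in>{1..n}. ennreal (exp (g i * \<xi> i / \<sigma>\<^sup>2 - (g i)\<^sup>2 / (2 * \<sigma>\<^sup>2)))) * indicator B \<xi> \<partial>noise_vector \<nu> n)"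
proof -
  interpret S: product_sigma_finite "\<lambda>_::nat. \<nu>" by (rule product_noise)
  let ?w = "\<lambda>i z. ennreal (exp (g i * z / \<sigma>\<^sup>2 - (g i)\<^sup>2 / (2 * \<sigma>\<^sup>2)))"
  define M' where "M' i = density \<nu> (?w i)" for i
  have w[measurable]: "?w i \<in> borel_measurable borel" for i by measurable
  have w\<nu>: "?w i \<in> borel_measurable \<nu>" for i unfolding measurable_cong_sets[OF sets_noise refl] by (rule w)
  have sets_M': "sets (M' i) = sets borel" for i by (simp add: M'_def sets_noise)
  have M'_eq: "emeasure (M' i) A = emeasure \<nu> {z. g i + z \<in> A}" if A[measurable]: "A \<in> sets borel" for i A
  proof -
    have "emeasure (M' i) A = (\<integral>\<^sup>+z. ?w i z * indicator A z \<partial>\<nu>)"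
      unfolding M'_def using A by (intro emeasure_density w\<nu>) (simp add: sets_noise)
    also have "\<dots> = (\<integral>\<^sup>+z. indicator A (g i + z) \<partial>\<nu>)"
      by (rule nn_integral_gaussian_shift[OF sigma_pos gaussian, symmetric]) measurable
    also have "\<dots> = (\<integral>\<^sup>+z. indicator {z. g i + z \<in> A} z \<partial>\<nu>)"
      by (intro nn_integral_cong) (simp add: indicator_def)
    also have "\<dots> = emeasure \<nu> {z. g i + z \<in> A}"
      by (intro nn_integral_indicator) (simp add: sets_noise)
    finally show ?thesis .
  qed
  have "prob_space (M' i)" for i
    using M'_eq[of UNIV i] noise.emeasure_space_1 sets_eq_imp_space_eq[OF sets_M'[of i]]
    by (intro prob_spaceI) simp
  then interpret Q: product_sigma_finite M'
    unfolding product_sigma_finite_def by (auto simp: prob_space_imp_sigma_finite)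
  have sets_PiM': "sets (PiM {1..n} M') = sets (vec_space n)"
    unfolding vec_space_def by (intro sets_PiM_cong refl sets_M')
  let ?shift = "\<lambda>\<xi>. \<lambda>i\<in>{1..n}. g i + \<xi> i"
  have shift: "?shift \<in> noise_vector \<nu> n \<rightarrow>\<^sub>M vec_space n"
    unfolding measurable_cong_sets[OF sets_noise_vector refl] vec_space_def
    by (rule measurable_restrict) measurable
  have W: "(\<lambda>\<xi>. \<Prod>i\<in>{1..n}. ?w i (\<xi> i)) \<in> borel_measurable (noise_vector \<nu> n)"
    unfolding measurable_cong_sets[OF sets_noise_vector refl] by measurable
  have 1: "distr (noise_vector \<nu> n) (vec_space n) ?shift = PiM {1..n} M'"
  proof (rule Q.PiM_eqI)
    show "sets (distr (noise_vector \<nu> n) (vec_space n) ?shift) = sets (PiM {1..n} M')" by (simp only: sets_distr sets_PiM')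
    fix A assume A: "\<And>i. i \<in> {1..n} \<Longrightarrow> A i \<in> sets (M' i)"
    then have A': "\<And>i. i \<in> {1..n} \<Longrightarrow> A i \<in> sets borel" by (simp add: sets_M')
    have box: "Pi\<^sub>E {1..n} A \<in> sets (vec_space n)"
      unfolding vec_space_def by (rule sets_PiM_I_finite) (auto intro: A')
    have pre: "?shift -` Pi\<^sub>E {1..n} A \<inter> space (noise_vector \<nu> n) = Pi\<^sub>E {1..n} (\<lambda>i. {z. g i + z \<in> A i})"
      unfolding space_noise_vector space_vec_space by (auto simp: PiE_iff extensional_def)
    have "emeasure (distr (noise_vector \<nu> n) (vec_space n) ?shift) (Pi\<^sub>E {1..n} A)
        = emeasure (noise_vector \<nu> n) (Pi\<^sub>E {1..n} (\<lambda>i. {z. g i + z \<in> A i}))"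
      by (subst emeasure_distr[OF shift box]) (simp only: pre)
    also have "\<dots> = (\<Prod>i\<in>{1..n}. emeasure \<nu> {z. g i + z \<in> A i})"
      unfolding noise_vector_def
    proof (rule S.emeasure_PiM)
      fix i assume "i \<in> {1..n}"
      then have [measurable]: "A i \<in> sets borel" by (rule A')
      show "{z. g i + z \<in> A i} \<in> sets \<nu>" unfolding sets_noise by measurable
    qed simp
    also have "\<dots> = (\<Prod>i\<in>{1..n}. emeasure (M' i) (A i))"
      by (intro prod.cong refl M'_eq[symmetric] A')
    finally show "emeasure (distr (noise_vector \<nu> n) (vec_space n) ?shift) (Pi\<^sub>E {1..n} A)
        = (\<Prod>i\<in>{1..n}. emeasure (M' i) (A i))" .
  qed simp
  have 2: "density (noise_vector \<nu> n) (\<lambda>\<xi>. \<Prod>i\<in>{1..n}. ?w i (\<xi> i)) = PiM {1..n} M'"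
  proof (rule Q.PiM_eqI)
    show "sets (density (noise_vector \<nu> n) (\<lambda>\<xi>. \<Prod>i\<in>{1..n}. ?w i (\<xi> i))) = sets (PiM {1..n} M')"
      by (simp only: sets_density sets_PiM' sets_noise_vector)
    fix A assume A: "\<And>i. i \<in> {1..n} \<Longrightarrow> A i \<in> sets (M' i)"
    then have A': "\<And>i. i \<in> {1..n} \<Longrightarrow> A i \<in> sets borel" by (simp add: sets_M')
    have box: "Pi\<^sub>E {1..n} A \<in> sets (noise_vector \<nu> n)"
      unfolding sets_noise_vector vec_space_def by (rule sets_PiM_I_finite) (auto intro: A')
    have ind: "indicator (Pi\<^sub>E {1..n} A) \<xi> = (\<Prod>i\<in>{1..n}. indicator (A i) (\<xi> i) :: ennreal)"
      if "\<xi> \<in> space (noise_vector \<nu> n)" for \<xi>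
    proof (cases "\<forall>i\<in>{1..n}. \<xi> i \<in> A i")
      case True
      then have "\<xi> \<in> Pi\<^sub>E {1..n} A" using that unfolding space_noise_vector space_vec_space by (simp add: PiE_iff)
      then show ?thesis using True by simp
    next
      case False
      then obtain i where i: "i \<in> {1..n}" "\<xi> i \<notin> A i" by blast
      then have "\<xi> \<notin> Pi\<^sub>E {1..n} A" by (meson PiE_mem)
      moreover have "(\<Prod>i\<in>{1..n}. indicator (A i) (\<xi> i) :: ennreal) = 0"
        by (rule prod_zero) (use i in \<open>auto intro!: bexI[of _ i]\<close>)
      ultimately show ?thesis by simp
    qed
    have "emeasure (density (noise_vector \<nu> n) (\<lambda>\<xi>. \<Prod>i\<in>{1..n}. ?w i (\<xi> i))) (Pi\<^sub>E {1..n} A)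
        = (\<integral>\<^sup>+\<xi>. (\<Prod>i\<in>{1..n}. ?w i (\<xi> i)) * indicator (Pi\<^sub>E {1..n} A) \<xi> \<partial>noise_vector \<nu> n)"
      by (rule emeasure_density[OF W box])
    also have "\<dots> = (\<integral>\<^sup>+\<xi>. (\<Prod>i\<in>{1..n}. ?w i (\<xi> i) * indicator (A i) (\<xi> i)) \<partial>noise_vector \<nu> n)"
      by (intro nn_integral_cong) (simp only: ind prod.distrib)
    also have "\<dots> = (\<Prod>i\<in>{1..n}. \<integral>\<^sup>+z. ?w i z * indicator (A i) z \<partial>\<nu>)"
      unfolding noise_vector_def
    proof (rule S.product_nn_integral_prod)
      fix i assume "i \<in> {1..n}"
      then have [measurable]: "A i \<in> sets borel" by (rule A')
      show "(\<lambda>z. ?w i z * indicator (A i) z) \<in> borel_measurable \<nu>"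
        unfolding measurable_cong_sets[OF sets_noise refl] by measurable
    qed simp
    also have "\<dots> = (\<Prod>i\<in>{1..n}. emeasure (M' i) (A i))"
      unfolding M'_def using A' by (intro prod.cong refl emeasure_density[symmetric] w\<nu>) (simp add: sets_noise)
    finally show "emeasure (density (noise_vector \<nu> n) (\<lambda>\<xi>. \<Prod>i\<in>{1..n}. ?w i (\<xi> i))) (Pi\<^sub>E {1..n} A)
        = (\<Prod>i\<in>{1..n}. emeasure (M' i) (A i))" .
  qed simp
  have "?shift -` B \<inter> space (noise_vector \<nu> n) = {\<xi> \<in> space (vec_space n). ?shift \<xi> \<in> B}"
    unfolding space_noise_vector by blast
  then have "emeasure (noise_vector \<nu> n) {\<xi> \<in> space (vec_space n). ?shift \<xi> \<in> B}
      = emeasure (distr (noise_vector \<nu> n) (vec_space n) ?shift) B"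
    by (simp only: emeasure_distr[OF shift B])
  also have "\<dots> = emeasure (density (noise_vector \<nu> n) (\<lambda>\<xi>. \<Prod>i\<in>{1..n}. ?w i (\<xi> i))) B"
    unfolding 1 2 ..
  also have "\<dots> = (\<integral>\<^sup>+\<xi>. (\<Prod>i\<in>{1..n}. ?w i (\<xi> i)) * indicator B \<xi> \<partial>noise_vector \<nu> n)"
    using B by (intro emeasure_density W) (simp add: sets_noise_vector)
  finally show ?thesis .
qed

end

context gaussian_regression
begin

text \<open>
  For the indicator of \<open>G\<close> this is the likelihood ratio of \<open>G\<close> against the empty set. General \<open>t\<close> are allowed so
  that products of likelihood ratios are of the same form.
\<close>
definition tilt :: "(real \<Rightarrow> real) \<Rightarrow> sample \<Rightarrow> real" where
  "tilt t = (\<lambda>(x, \<xi>). exp (\<Sum>i\<in>{1..n}. t (x i) * (\<xi> i - 1 / 2) / \<sigma>\<^sup>2))"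

abbreviation joint :: "sample measure" where
  "joint \<equiv> D n \<Otimes>\<^sub>M noise_vector \<nu> n"

lemma prob_space_joint: "prob_space joint"
proof -
  interpret N: prob_space "noise_vector \<nu> n" by (rule prob_space_noise_vector)
  interpret J: pair_prob_space "D n" "noise_vector \<nu> n" ..
  show ?thesis by (rule J.P.prob_space_axioms)
qed

lemma tilt_measurable:
  assumes [measurable]: "t \<in> borel_measurable borel"
  shows "tilt t \<in> borel_measurable joint"
proof -
  have [measurable]: "(\<lambda>\<omega>. fst \<omega> i) \<in> borel_measurable (sample_space n)"
    "(\<lambda>\<omega>. snd \<omega> i) \<in> borel_measurable (sample_space n)" if "i \<in> {1..n}" for i
    by (rule sample_space_components[OF that])+
  show ?thesis
    unfolding measurable_cong_sets[OF sets_joint refl] tilt_def split_beta by measurable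
qed

lemma tilt_pos: "0 < tilt t \<omega>"
  by (simp add: tilt_def split_beta)

lemma tilt_eq_prod: "ennreal (tilt t (x, \<xi>)) = (\<Prod>i\<in>{1..n}. ennreal (exp (t (x i) * (\<xi> i - 1 / 2) / \<sigma>\<^sup>2)))"
  by (simp add: tilt_def exp_sum prod_ennreal)

lemma tilt_mult: "tilt s \<omega> * tilt t \<omega> = tilt (\<lambda>z. s z + t z) \<omega>"
  by (simp add: tilt_def split_beta exp_add[symmetric] sum.distrib[symmetric] algebra_simps add_divide_distrib[symmetric])

text \<open>
  Only the values of \<open>t\<close> with \<open>t\<^sup>2 \<noteq> t\<close> matter. So every likelihood ratio, and every product of two
  for disjoint sets, has expectation 1, whereas the square of a likelihood ratio has \<open>t = 2\<close> on the segment.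
\<close>
lemma nn_integral_tilt:
  assumes t: "t \<in> borel_measurable borel"
  shows "(\<integral>\<^sup>+\<omega>. ennreal (tilt t \<omega>) \<partial>joint)
    = (\<integral>\<^sup>+x. ennreal (exp (\<Sum>i\<in>{1..n}. ((t (x i))\<^sup>2 - t (x i)) / (2 * \<sigma>\<^sup>2))) \<partial>D n)"
proof -
  interpret N: prob_space "noise_vector \<nu> n" by (rule prob_space_noise_vector)
  interpret S: product_sigma_finite "\<lambda>_::nat. \<nu>" by (rule product_noise)
  have "(\<integral>\<^sup>+\<omega>. ennreal (tilt t \<omega>) \<partial>joint) = (\<integral>\<^sup>+x. \<integral>\<^sup>+\<xi>. ennreal (tilt t (x, \<xi>)) \<partial>noise_vector \<nu> n \<partial>D n)"
    using tilt_measurable[OF t] by (intro N.nn_integral_fst[symmetric]) simp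
  also have "\<dots> = (\<integral>\<^sup>+x. ennreal (exp (\<Sum>i\<in>{1..n}. ((t (x i))\<^sup>2 - t (x i)) / (2 * \<sigma>\<^sup>2))) \<partial>D n)"
  proof (rule nn_integral_cong)
    fix x
    have "(\<integral>\<^sup>+\<xi>. ennreal (tilt t (x, \<xi>)) \<partial>noise_vector \<nu> n)
        = (\<Prod>i\<in>{1..n}. \<integral>\<^sup>+z. ennreal (exp (t (x i) * (z - 1 / 2) / \<sigma>\<^sup>2)) \<partial>\<nu>)"
      unfolding tilt_eq_prod noise_vector_def
      by (rule S.product_nn_integral_prod) (simp_all add: measurable_cong_sets[OF sets_noise refl])
    also have "\<dots> = ennreal (exp (\<Sum>i\<in>{1..n}. ((t (x i))\<^sup>2 - t (x i)) / (2 * \<sigma>\<^sup>2)))"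
      unfolding nn_integral_gaussian_exp by (simp add: exp_sum prod_ennreal)
    finally show "(\<integral>\<^sup>+\<xi>. ennreal (tilt t (x, \<xi>)) \<partial>noise_vector \<nu> n)
        = ennreal (exp (\<Sum>i\<in>{1..n}. ((t (x i))\<^sup>2 - t (x i)) / (2 * \<sigma>\<^sup>2)))" .
  qed
  finally show ?thesis .
qed

lemma tilt_integral_one:
  assumes t: "t \<in> borel_measurable borel" and range: "\<And>z. t z = 0 \<or> t z = 1"
  shows "integrable joint (tilt t)" "(\<integral>\<omega>. tilt t \<omega> \<partial>joint) = 1"
proof -
  have "(t z)\<^sup>2 - t z = 0" for z using range[of z] by auto
  then have "(\<integral>\<^sup>+\<omega>. ennreal (tilt t \<omega>) \<partial>joint) = ennreal 1"
    using design.emeasure_space_1 by (simp add: nn_integral_tilt[OF t])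
  then have "has_bochner_integral joint (tilt t) 1"
    using tilt_measurable[OF t] by (intro has_bochner_integral_nn_integral) (auto intro: less_imp_le tilt_pos)
  then show "integrable joint (tilt t)" "(\<integral>\<omega>. tilt t \<omega> \<partial>joint) = 1"
    by (auto simp: has_bochner_integral_iff)
qed

text \<open>
  Each design point in the segment contributes a factor \<open>exp (1 / \<sigma>\<^sup>2)\<close>, so the second moment is an exponential
  moment of the count.
\<close>
lemma tilt_indicator_square:
  assumes ab: "0 \<le> a" "a \<le> b" "b \<le> 1"
  defines "L \<equiv> tilt (indicator {a..b})"
  shows "integrable joint (\<lambda>\<omega>. L \<omega> * L \<omega>)"
    "(\<integral>\<omega>. L \<omega> * L \<omega> \<partial>joint) \<le> exp (1 / \<sigma>\<^sup>2 + (exp (1 / \<sigma>\<^sup>2) - 1) * (real n * (b - a)))"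
proof -
  define t :: "real \<Rightarrow> real" where "t = (\<lambda>z. indicator {a..b} z + indicator {a..b} z)"
  have t: "t \<in> borel_measurable borel" unfolding t_def by measurable
  have LL: "L \<omega> * L \<omega> = tilt t \<omega>" for \<omega> unfolding L_def tilt_mult t_def ..
  have "((t z)\<^sup>2 - t z) / (2 * \<sigma>\<^sup>2) = 1 / \<sigma>\<^sup>2 * indicator {a..b} z" for z
    by (simp add: t_def indicator_def)
  then have "(\<Sum>i\<in>{1..n}. ((t (x i))\<^sup>2 - t (x i)) / (2 * \<sigma>\<^sup>2)) = 1 / \<sigma>\<^sup>2 * real (card (hits n {a..b} x))" for x
    unfolding card_hits_eq_sum by (simp only: sum_distrib_left)
  then have "(\<integral>\<^sup>+\<omega>. ennreal (tilt t \<omega>) \<partial>joint) = (\<integral>\<^sup>+x. ennreal (exp (1 / \<sigma>\<^sup>2 * real (card (hits n {a..b} x)))) \<partial>D n)"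
    by (simp only: nn_integral_tilt[OF t])
  also have "\<dots> = ennreal (\<integral>x. exp (1 / \<sigma>\<^sup>2 * real (card (hits n {a..b} x))) \<partial>D n)"
    by (rule nn_integral_eq_integral[OF exp_hits_integrable]) auto
  finally have "has_bochner_integral joint (tilt t) (\<integral>x. exp (1 / \<sigma>\<^sup>2 * real (card (hits n {a..b} x))) \<partial>D n)"
    using tilt_measurable[OF t]
    by (intro has_bochner_integral_nn_integral) (auto intro: less_imp_le tilt_pos integral_nonneg_AE)
  then show "integrable joint (\<lambda>\<omega>. L \<omega> * L \<omega>)"
    "(\<integral>\<omega>. L \<omega> * L \<omega> \<partial>joint) \<le> exp (1 / \<sigma>\<^sup>2 + (exp (1 / \<sigma>\<^sup>2) - 1) * (real n * (b - a)))"
    using design.exp_hits_le[OF ab, of "1 / \<sigma>\<^sup>2"] unfolding LL by (auto simp: has_bochner_integral_iff)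
qed

lemma tilt_indicator_disjoint:
  assumes G: "G \<in> sets borel" "G' \<in> sets borel" and disj: "G \<inter> G' = {}"
  shows "integrable joint (\<lambda>\<omega>. tilt (indicator G) \<omega> * tilt (indicator G') \<omega>)"
    "(\<integral>\<omega>. tilt (indicator G) \<omega> * tilt (indicator G') \<omega> \<partial>joint) = 1"
proof -
  have "indicator G z + indicator G' z = (0::real) \<or> indicator G z + indicator G' z = (1::real)" for z
    using disj by (auto simp: indicator_def)
  moreover have "(\<lambda>z. indicator G z + indicator G' z :: real) \<in> borel_measurable borel"
    using G by measurable
  ultimately show "integrable joint (\<lambda>\<omega>. tilt (indicator G) \<omega> * tilt (indicator G') \<omega>)"
    "(\<integral>\<omega>. tilt (indicator G) \<omega> * tilt (indicator G') \<omega> \<partial>joint) = 1"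
    unfolding tilt_mult by (auto intro!: tilt_integral_one)
qed

text \<open>
  Change of measure for a fixed design. Since an indicator equals its square, the density is the exponential of
  \<open>1(x i \<in> G) * (\<xi> i - 1/2) / \<sigma>\<^sup>2\<close>.
\<close>
lemma emeasure_obs_law_eq_tilt:
  assumes G: "G \<in> sets borel" and A: "A \<in> sets (sample_space n)"
  shows "emeasure (obs_law D \<nu> n G) A = (\<integral>\<^sup>+\<omega>. ennreal (tilt (indicator G) \<omega> * indicator A \<omega>) \<partial>joint)"
proof -
  interpret N: prob_space "noise_vector \<nu> n" by (rule prob_space_noise_vector)
  have A': "A \<in> sets joint" using A by (simp only: sets_joint)
  have t: "(indicator G :: real \<Rightarrow> real) \<in> borel_measurable borel" using G by measurable
  have "emeasure (obs_law D \<nu> n G) A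
      = (\<integral>\<^sup>+x. \<integral>\<^sup>+\<xi>. ennreal (tilt (indicator G) (x, \<xi>) * indicator A (x, \<xi>)) \<partial>noise_vector \<nu> n \<partial>D n)"
    unfolding emeasure_obs_law[OF G A]
  proof (rule nn_integral_cong)
    fix x
    have B: "Pair x -` A \<in> sets (vec_space n)"
      using sets_Pair1[of A "vec_space n" "vec_space n" x] A by (simp add: sample_space_def)
    have "emeasure (noise_vector \<nu> n) {\<xi> \<in> space (vec_space n). observe n G x \<xi> \<in> A}
        = emeasure (noise_vector \<nu> n) {\<xi> \<in> space (vec_space n). (\<lambda>i\<in>{1..n}. indicator G (x i) + \<xi> i) \<in> Pair x -` A}"
      by (simp add: observe_def)
    also have "\<dots> = (\<integral>\<^sup>+\<xi>. (\<Prod>i\<in>{1..n}. ennreal (exp (indicator G (x i) * \<xi> i / \<sigma>\<^sup>2 - (indicator G (x i))\<^sup>2 / (2 * \<sigma>\<^sup>2))))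
        * indicator (Pair x -` A) \<xi> \<partial>noise_vector \<nu> n)"
      by (rule emeasure_noise_vector_shift[OF B])
    also have "\<dots> = (\<integral>\<^sup>+\<xi>. ennreal (tilt (indicator G) (x, \<xi>) * indicator A (x, \<xi>)) \<partial>noise_vector \<nu> n)"
    proof (rule nn_integral_cong)
      fix \<xi> :: "nat \<Rightarrow> real"
      have "indicator G (x i) * \<xi> i / \<sigma>\<^sup>2 - (indicator G (x i))\<^sup>2 / (2 * \<sigma>\<^sup>2) = indicator G (x i) * (\<xi> i - 1 / 2) / \<sigma>\<^sup>2" for i
        using sigma_pos by (simp add: indicator_def field_simps)
      then have "(\<Prod>i\<in>{1..n}. ennreal (exp (indicator G (x i) * \<xi> i / \<sigma>\<^sup>2 - (indicator G (x i))\<^sup>2 / (2 * \<sigma>\<^sup>2))))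
          = ennreal (tilt (indicator G) (x, \<xi>))"
        by (simp only: tilt_eq_prod)
      then show "(\<Prod>i\<in>{1..n}. ennreal (exp (indicator G (x i) * \<xi> i / \<sigma>\<^sup>2 - (indicator G (x i))\<^sup>2 / (2 * \<sigma>\<^sup>2))))
          * indicator (Pair x -` A) \<xi> = ennreal (tilt (indicator G) (x, \<xi>) * indicator A (x, \<xi>))"
        by (simp add: indicator_def)
    qed
    finally show "emeasure (noise_vector \<nu> n) {\<xi> \<in> space (vec_space n). observe n G x \<xi> \<in> A}
        = (\<integral>\<^sup>+\<xi>. ennreal (tilt (indicator G) (x, \<xi>) * indicator A (x, \<xi>)) \<partial>noise_vector \<nu> n)" .
  qed
  also have "\<dots> = (\<integral>\<^sup>+\<omega>. ennreal (tilt (indicator G) \<omega> * indicator A \<omega>) \<partial>joint)"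
  proof (rule N.nn_integral_fst)
    have [measurable]: "tilt (indicator G) \<in> borel_measurable joint" by (rule tilt_measurable[OF t])
    show "(\<lambda>\<omega>. ennreal (tilt (indicator G) \<omega> * indicator A \<omega>)) \<in> borel_measurable joint"
      using A' by measurable
  qed
  finally show ?thesis .
qed

lemma measure_obs_law_eq_tilt:
  assumes G: "G \<in> sets borel" and A: "A \<in> sets (sample_space n)"
  shows "measure (obs_law D \<nu> n G) A = (\<integral>\<omega>. tilt (indicator G) \<omega> * indicator A \<omega> \<partial>joint)"
proof -
  have [measurable]: "tilt (indicator G) \<in> borel_measurable joint" "A \<in> sets joint"
    using G A by (auto intro!: tilt_measurable simp: sets_joint)
  have "(\<integral>\<omega>. tilt (indicator G) \<omega> * indicator A \<omega> \<partial>joint)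
      = enn2real (\<integral>\<^sup>+\<omega>. ennreal (tilt (indicator G) \<omega> * indicator A \<omega>) \<partial>joint)"
    by (intro integral_eq_nn_integral) (auto intro!: mult_nonneg_nonneg less_imp_le[OF tilt_pos])
  then show ?thesis unfolding measure_def emeasure_obs_law_eq_tilt[OF assms] by simp
qed

section \<open>Lower bound for general segments\<close>

text \<open>
  The alternatives are the segments \<open>[2 * j * h, 2 * j * h + h]\<close>. The gaps between them keep the closed segments
  disjoint, so that a design point on a common boundary cannot correlate two likelihood ratios. Their number is at
  least \<open>1 / (4 * h)\<close>.
\<close>
lemma test_risk_segments_ge:
  assumes h: "0 < h" "h \<le> 1 / 4" and \<tau>: "is_test n \<tau>"
  shows "1 - sqrt (4 * h * exp (1 / \<sigma>\<^sup>2 + (exp (1 / \<sigma>\<^sup>2) - 1) * (real n * h))) \<le> test_risk D \<nu> n h \<tau> segments"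
proof -
  interpret J: prob_space joint by (rule prob_space_joint)
  define m where "m = nat \<lfloor>1 / (2 * h)\<rfloor>"
  define G where "G j = {2 * real j * h..2 * real j * h + h}" for j
  define L where "L j = tilt (indicator (G j))" for j
  define V where "V = exp (1 / \<sigma>\<^sup>2 + (exp (1 / \<sigma>\<^sup>2) - 1) * (real n * h))"
  define A where "A = {\<omega> \<in> space (sample_space n). \<tau> \<omega> = 1}"
  define B where "B = {\<omega> \<in> space (sample_space n). \<tau> \<omega> = 0}"
  have A: "A \<in> sets (sample_space n)" and B: "B \<in> sets (sample_space n)"
    using is_test_sets[OF \<tau>] by (simp_all add: A_def B_def)
  have "1 / (4 * h) \<le> 1 / (2 * h) - 1" using h by (simp add: field_simps)
  moreover have "real m = of_int \<lfloor>1 / (2 * h)\<rfloor>" using h unfolding m_def by simp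
  then have "1 / (2 * h) - 1 < real m" "real m \<le> 1 / (2 * h)" by linarith+
  ultimately have m: "1 / (4 * h) < real m" "real m \<le> 1 / (2 * h)" by linarith+
  have "0 < 1 / (4 * h)" using h by simp
  then have m_pos: "0 < real m" using m(1) by linarith
  have fit: "2 * real j * h + h \<le> 1" if "j < m" for j
  proof -
    have "real (Suc j) \<le> real m" using that by simp
    then have "real (Suc j) \<le> 1 / (2 * h)" using m(2) by linarith
    then show ?thesis using h by (simp add: field_simps)
  qed
  have GB: "G j \<in> sets borel" for j by (simp add: G_def)
  have G_long: "G j \<in> long_members segments h" if "j < m" for j
    unfolding long_members_segments G_def using fit[OF that] h
    by (intro exI[of _ "2 * real j * h"] exI[of _ "2 * real j * h + h"]) auto
  have disj: "G j \<inter> G k = {}" if "j \<noteq> k" for j k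
  proof -
    have less: "G j \<inter> G k = {}" if "j < k" for j k
    proof -
      have "real j + 1 \<le> real k" using that by simp
      then have "(real j + 1) * (2 * h) \<le> real k * (2 * h)" using h by (intro mult_right_mono) auto
      then have "2 * real j * h + h < 2 * real k * h" using h by (simp add: algebra_simps)
      then show ?thesis unfolding G_def by auto
    qed
    show ?thesis using less[of j k] less[of k j] that by (cases "j < k") (auto simp: Int_commute)
  qed
  have sq: "integrable joint (\<lambda>\<omega>. L j \<omega> * L j \<omega>)" "(\<integral>\<omega>. L j \<omega> * L j \<omega> \<partial>joint) \<le> V" if "j < m" for j
    using tilt_indicator_square[of "2 * real j * h" "2 * real j * h + h"] fit[OF that] h
    by (auto simp: L_def G_def V_def)
  have one: "integrable joint (L j)" "(\<integral>\<omega>. L j \<omega> \<partial>joint) = 1" for j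
    unfolding L_def using GB[of j] by (auto intro!: tilt_integral_one simp: indicator_def)
  have off: "integrable joint (\<lambda>\<omega>. L j \<omega> * L k \<omega>)" "(\<integral>\<omega>. L j \<omega> * L k \<omega> \<partial>joint) = 1" if "j \<noteq> k" for j k
    unfolding L_def using tilt_indicator_disjoint[OF GB GB disj[OF that]] by auto
  define \<beta> where "\<beta> = test_risk D \<nu> n h \<tau> segments - measure (obs_law D \<nu> n {}) A"
  have "J.prob B - sqrt (V / real (card {..<m})) \<le> \<beta>"
  proof (rule J.mixture_second_moment[where L=L])
    show "{..<m} \<noteq> {}" using m_pos by auto
    show "0 < V" by (simp add: V_def)
    show "B \<in> J.events" using B by (simp only: sets_joint)
    show "integrable joint (\<lambda>\<omega>. L j \<omega> * L k \<omega>)" if "j \<in> {..<m}" "k \<in> {..<m}" for j k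
      using sq(1)[of j] off(1)[of j k] that by (cases "j = k") auto
    show "(\<integral>\<omega>. L j \<omega> * L k \<omega> \<partial>joint) \<le> 1" if "j \<noteq> k" for j k using off(2)[OF that] by simp
    show "(\<integral>\<omega>. L j \<omega> * L j \<omega> \<partial>joint) \<le> V" if "j \<in> {..<m}" for j using sq(2) that by simp
    show "(\<integral>\<omega>. L j \<omega> * indicator B \<omega> \<partial>joint) \<le> \<beta>" if "j \<in> {..<m}" for j
    proof -
      have "j < m" using that by simp
      have "(\<integral>\<omega>. L j \<omega> * indicator B \<omega> \<partial>joint) = measure (obs_law D \<nu> n (G j)) B"
        unfolding L_def by (rule measure_obs_law_eq_tilt[OF GB B, symmetric])
      then show ?thesis
        using test_risk_ge[OF G_long[OF \<open>j < m\<close>] segments_borel(1), of \<tau>]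
        unfolding \<beta>_def A_def B_def by simp
    qed
  qed (use one in auto)
  moreover have "J.prob B = measure (obs_law D \<nu> n {}) B"
  proof -
    have "measure (obs_law D \<nu> n {}) B = (\<integral>\<omega>. indicator B \<omega> \<partial>joint)"
      by (simp add: measure_obs_law_eq_tilt[OF _ B] tilt_def split_beta)
    then show ?thesis using B by (simp add: sets_joint)
  qed
  moreover have "measure (obs_law D \<nu> n {}) B = 1 - measure (obs_law D \<nu> n {}) A"
    unfolding A_def B_def by (rule is_test_complement[OF prob_space_obs_law sets_obs_law \<tau>]) simp
  moreover have "sqrt (V / real m) \<le> sqrt (4 * h * V)"
  proof (rule real_sqrt_le_mono)
    have "1 / real m \<le> 4 * h" using m(1) m_pos h by (simp add: field_simps)
    then have "V * (1 / real m) \<le> V * (4 * h)" by (rule mult_left_mono) (simp add: V_def)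
    then show "V / real m \<le> 4 * h * V" by (simp add: mult.commute)
  qed
  ultimately show ?thesis unfolding \<beta>_def V_def[symmetric] card_lessThan by linarith
qed

end

text \<open>
  When \<open>n * h \<le> e * ln n\<close> with \<open>e = 1 / (2 * (exp a - 1))\<close>, the second moment is at most a constant times
  \<open>sqrt n\<close>, while the number of alternatives is of order at least \<open>n / ln n\<close>.
\<close>
theorem no_consistent_test_segments:
  assumes reg: "\<And>n. 1 \<le> n \<Longrightarrow> gaussian_regression D n \<nu> \<sigma>"
    and h: "\<forall>n\<ge>1. 0 < h n \<and> h n < 1"
    and lim: "(\<lambda>n. h n / (ln (real n) / real n)) \<longlonglongrightarrow> 0"
  shows "\<not> consistent_test D \<nu> h segments \<tau>"
proof
  assume "consistent_test D \<nu> h segments \<tau>"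
  then have \<tau>: "\<And>n. 1 \<le> n \<Longrightarrow> is_test n (\<tau> n)"
    and risk: "(\<lambda>n. test_risk D \<nu> n (h n) (\<tau> n) segments) \<longlonglongrightarrow> 0"
    unfolding consistent_test_def by auto
  have \<sigma>: "0 < \<sigma>" using gaussian_regression.sigma_pos[OF reg[of 1]] by simp
  define a where "a = 1 / \<sigma>\<^sup>2"
  have a: "0 < a" using \<sigma> by (simp add: a_def)
  define e where "e = 1 / (2 * (exp a - 1))"
  have e: "0 < e" using a by (simp add: e_def)
  define b where "b n = 4 * (ln (real n) / real n) * (exp a * real n powr (1 / 2))" for n
  have small: "\<forall>\<^sub>F n in sequentially. h n / (ln (real n) / real n) < min 1 e"
    using lim e by (intro order_tendstoD(2)[OF lim]) simp
  have "(\<lambda>n. ln (real n) / real n) \<longlonglongrightarrow> 0" by real_asymp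
  then have log_small: "\<forall>\<^sub>F n in sequentially. ln (real n) / real n < 1 / 4"
    by (rule order_tendstoD) simp
  have "\<forall>\<^sub>F n in sequentially. 1 - sqrt (b n) \<le> test_risk D \<nu> n (h n) (\<tau> n) segments"
    using small log_small eventually_ge_at_top[of 2]
  proof eventually_elim
    case (elim n)
    interpret gaussian_regression D n \<nu> \<sigma> by (rule reg) (use elim in simp)
    have hn: "0 < h n" using h elim by auto
    have ln: "0 < ln (real n) / real n" using elim by simp
    have "h n / (ln (real n) / real n) < 1" "h n / (ln (real n) / real n) < e" using elim by auto
    then have h1: "h n \<le> ln (real n) / real n" and "h n < e * (ln (real n) / real n)"
      by (simp_all only: pos_divide_less_eq[OF ln] mult_1_left less_imp_le)
    then have "real n * h n \<le> e * ln (real n)" using elim by (simp add: field_simps)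
    then have "(exp a - 1) * (real n * h n) \<le> (exp a - 1) * (e * ln (real n))"
      using a by (intro mult_left_mono) auto
    also have "\<dots> = 1 / 2 * ln (real n)"
    proof -
      have "d * (1 / (2 * d) * l) = 1 / 2 * l" if "0 < d" for d l :: real using that by simp
      from this[of "exp a - 1"] show ?thesis using a unfolding e_def by simp
    qed
    finally have "exp (a + (exp a - 1) * (real n * h n)) \<le> exp (a + 1 / 2 * ln (real n))" by simp
    also have "\<dots> = exp a * real n powr (1 / 2)" using elim by (simp add: exp_add powr_def)
    finally have "4 * h n * exp (a + (exp a - 1) * (real n * h n)) \<le> b n"
      unfolding b_def using h1 hn by (intro mult_mono) auto
    then have "1 - sqrt (b n) \<le> 1 - sqrt (4 * h n * exp (a + (exp a - 1) * (real n * h n)))" by simp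
    also have "\<dots> \<le> test_risk D \<nu> n (h n) (\<tau> n) segments"
      unfolding a_def using test_risk_segments_ge[OF hn _ \<tau>] h1 elim by simp
    finally show ?case .
  qed
  moreover have "(\<lambda>n. 1 - sqrt (b n)) \<longlonglongrightarrow> 1"
  proof -
    have "b \<longlonglongrightarrow> 0" unfolding b_def by real_asymp
    then have "(\<lambda>n. 1 - sqrt (b n)) \<longlonglongrightarrow> 1 - sqrt 0" by (intro tendsto_intros)
    then show ?thesis by simp
  qed
  ultimately have "(1 :: real) \<le> 0"
    using risk by (intro tendsto_le[OF sequentially_bot]) auto
  then show False by simp
qed

section \<open>Separation rates\<close>

theorem theorem1:
  fixes D :: "nat \<Rightarrow> (nat \<Rightarrow> real) measure"
    and \<nu> :: "real measure"
    and \<sigma> :: real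
    and h :: "nat \<Rightarrow> real"
  assumes design: "D = deterministic_design \<or> D = random_design"
    and sigma_pos: "0 < \<sigma>"
    and noise: "subgaussian_noise \<sigma> \<nu>"
    and h_range: "\<forall>n\<ge>1. 0 < h n \<and> h n < 1"
  shows
    "(measure \<nu> {x. x \<le> - 1 / 2} < measure \<nu> {x. x \<le> 1 / 2} \<longrightarrow>
        (filterlim (\<lambda>n. real n * h n) at_top sequentially \<longrightarrow>
           (\<forall>c. measure \<nu> {x. x \<le> - 1 / 2} < c \<and> c < measure \<nu> {x. x \<le> 1 / 2} \<longrightarrow>
              consistent_test D \<nu> h segments0 (\<lambda>n. test0 c n (h n)))) \<and>
        (gaussian_noise \<sigma> \<nu> \<longrightarrow>
           separation_rate D \<nu> segments0 (\<lambda>n. 1 / real n)))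
     \<and>
     (filterlim (\<lambda>n. real n * h n / ln (real n)) at_top sequentially \<longrightarrow>
        consistent_test D \<nu> h segments (\<lambda>n. test1 n (h n))) \<and>
     (gaussian_noise \<sigma> \<nu> \<longrightarrow>
        separation_rate D \<nu> segments (\<lambda>n. ln (real n) / real n))"
proof -
  have prob: "prob_space \<nu>" and sets: "sets \<nu> = sets borel"
    using noise by (auto simp: subgaussian_noise_def)
  have spread: "spread_design n (D n)" if "1 \<le> n" for n
    using design spread_deterministic_design[OF that] spread_random_design by auto
  have reg: "regression D n \<nu>" if "1 \<le> n" for n
    using spread[OF that] prob sets by (simp add: regression_def regression_axioms_def)
  have subg: "subgaussian_regression D n \<nu> \<sigma>" if "1 \<le> n" for n
    using reg[OF that] sigma_pos noise
    by (simp add: subgaussian_regression_def subgaussian_regression_axioms_def)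
  have gauss: "gaussian_regression D n \<nu> \<sigma>" if "gaussian_noise \<sigma> \<nu>" "1 \<le> n" for n
    using reg[OF that(2)] sigma_pos that(1)
    by (simp add: gaussian_regression_def gaussian_regression_axioms_def)
  have rate0: "separation_rate D \<nu> segments0 (\<lambda>n. 1 / real n)"
    if gap: "measure \<nu> {x. x \<le> - 1 / 2} < measure \<nu> {x. x \<le> 1 / 2}"
  proof -
    obtain c where c: "measure \<nu> {x. x \<le> - 1 / 2} < c" "c < measure \<nu> {x. x \<le> 1 / 2}"
      using dense[OF gap] by blast
    have "(\<exists>\<tau>. consistent_test D \<nu> g segments0 \<tau>)"
      if "\<forall>n\<ge>1. 0 < g n \<and> g n < 1" "filterlim (\<lambda>n. g n / (1 / real n)) at_top sequentially" for g
    proof -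
      have "filterlim (\<lambda>n. real n * g n) at_top sequentially"
        using that(2) by (simp add: mult.commute)
      then show ?thesis using test0_consistent[OF reg that(1) _ c] by blast
    qed
    moreover have "\<not> (\<exists>\<tau>. consistent_test D \<nu> g segments0 \<tau>)"
      if "\<forall>n\<ge>1. 0 < g n \<and> g n < 1" "(\<lambda>n. g n / (1 / real n)) \<longlonglongrightarrow> 0" for g
    proof -
      have "(\<lambda>n. real n * g n) \<longlonglongrightarrow> 0" using that(2) by (simp add: mult.commute)
      then show ?thesis using no_consistent_test_initial_segments[OF reg that(1)] by blast
    qed
    moreover have "\<forall>\<^sub>F n in sequentially. 0 < 1 / real n"
      using eventually_gt_at_top[of 0] by eventually_elim simp
    ultimately show ?thesis unfolding separation_rate_def by blast
  qed
  have rate1: "separation_rate D \<nu> segments (\<lambda>n. ln (real n) / real n)" if "gaussian_noise \<sigma> \<nu>"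
  proof -
    have "(\<exists>\<tau>. consistent_test D \<nu> g segments \<tau>)"
      if "\<forall>n\<ge>1. 0 < g n \<and> g n < 1" "filterlim (\<lambda>n. g n / (ln (real n) / real n)) at_top sequentially" for g
    proof -
      have "filterlim (\<lambda>n. real n * g n / ln (real n)) at_top sequentially"
        using that(2) by (simp add: mult.commute)
      then show ?thesis using test1_consistent[OF subg that(1)] by blast
    qed
    moreover have "\<forall>\<^sub>F n in sequentially. 0 < ln (real n) / real n"
      using eventually_gt_at_top[of 1] by eventually_elim simp
    ultimately show ?thesis
      using no_consistent_test_segments[OF gauss[OF that]] unfolding separation_rate_def by blast
  qed
  show ?thesis
    using test0_consistent[OF reg h_range] rate0 test1_consistent[OF subg h_range] rate1 by blast
qed

end
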